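(* Let $k\ge 1$. Every $k$-strategy $\Sigma$ determines, for every set $\mathcal{P}$ of $k$-profiles in a graph $G$, a canonical nested separation system $N_\Sigma(G,\mathcal{P})$ consisting of $\mathcal{P}$-essential separations of $G$ of order $<k$ that distinguishes all the profiles in $\mathcal{P}$ efficiently. That is: the recursion defining $N_\Sigma(G,\mathcal{P})$ succeeds; $N_\Sigma(G,\mathcal{P})$ is a nested separation system all of whose elements are $\mathcal{P}$-essential and have order $<k$; for every two distinct $P,P'\in\mathcal{P}$ some separation in $N_\Sigma(G,\mathcal{P})$ distinguishes $P$ from $P'$ efficiently; and, for each $\Sigma$, the map $(G,\mathcal{P})\mapsto N_\Sigma(G,\mathcal{P})$ commutes with all graph isomorphisms $G\to G'$.
   Context: **Separations.** All graphs are finite, undirected and simple; $G$ has vertex set $V$. A separation of $G$ is a pair $(A,B)$ with $A,B\subseteq V$, $A\cup B=V$, such that $G$ has no edge between $A\setminus B$ and $B\setminus A$. Its order is $|A\cap B|$, its inverse is $(B,A)$; it is proper if neither $A\subseteq B$ nor $B\subseteq A$. A $k$-separation is one of order exactly $k$. Write $(A,B)\le(C,D)$ if $A\subseteq C$ and $B\supseteq D$. Two separations $(A,B),(C,D)$ are nested if $(A,B)$ is $\le$-comparable with $(C,D)$ or with $(D,C)$; otherwise they cross. A separation is nested with a set $S$ of separations if it is nested with every element of $S$. A set of separations is nested if every two of its elements are nested. A separation system is a set of separations closed under taking inverses; it is proper if all its elements are proper. A set of separations is antisymmetric if it contains no separation together with its inverse. **Profiles.** A set $P$ of separations is consistent if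 whenever $(A,B)\in P$ and $(C,D)\le(A,B)$ is a separation, then $(D,C)\notin P$. A profile is a consistent set $P$ of separations such that for all $(A,B),(C,D)\in P$ we have $(B\cap D,A\cup C)\notin P$. A $k$-profile is a profile $P$ all of whose elements have order $<k$ and which contains, for every separation $(A,B)$ of order $<k$, exactly one of $(A,B),(B,A)$. An antisymmetric set $P$ of separations orients a set $S$ of separations if for every $(A,B)\in S$ either $(A,B)\in P$ or $(B,A)\in P\cap S$; then $P\cap S$ is an orientation of $S$. A separation $(A,B)$ distinguishes two sets $P,P'$ of separations if $(A,B)\in P\setminus P'$ and $(B,A)\in P'\setminus P$, or vice versa. A set $S$ of separations distinguishes a set $\mathcal{P}$ of sets of separations if every two distinct elements of $\mathcal{P}$ are distinguished by some element of $S$. A separation $(A,B)$ splits a consistent set $O$ if both $O\cup\{(A,B)\}$ and $O\cup\{(B,A)\}$ are consistent. **Efficiency.** $\kappa(P,P')$ denotes the least order of a separation of $G$ that distinguishes the profiles $P,P'$. A separation of order $\ell$ that distinguishes $P$ from $P'$ does so efficiently if $\kappa(P,P')=\ell$. A separation is $\mathcal{P}$-essential if it efficiently distinguishes some pair of profiles in $\mathcal{P}$. **Tasks.** A task is a pair $(S,\mathcal{P})$ of a proper separation system $S$ and a set $\mathcal{P}$ of profiles in $G$ such that every $P\in\mathcal{P}$ orients $S$ and $S$ distinguishes $\mathcal{P}$. It is feasible if, whenever $(A,B),(C,D)\in S$ cross and there are $P,P'\in\mathcal{P}$ with $(A,B),(C,D)\in P$ and $(B,A),(D,C)\in P'$,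 there is $(E,F)\in P\cap S$ with $(A\cup C,B\cap D)\le(E,F)$. The reduction of $(S,\mathcal{P})$ is $(R,\mathcal{P})$, where $R$ is the set of those separations in $S$ that distinguish some two profiles in $\mathcal{P}$. **Operations.** A separation $(A,B)\in S$ is extremal in $S$ if every $(C,D)\in S$ satisfies $(C,D)\le(A,B)$ or $(D,C)\le(A,B)$. A profile $P$ orienting $S$ is well separated in $S$ if the set of $\le$-maximal elements of $P\cap S$ is nested. A separation is locally maximal in $(S,\mathcal{P})$ if it is $\le$-maximal in $P\cap S$ for some $P\in\mathcal{P}$ that is well separated in $S$. Let $\mathsf{ext}(S,\mathcal{P})$ be the set of extremal separations in $S$ and their inverses; $\mathsf{loc}(S,\mathcal{P})$ the set of locally maximal separations in $(S,\mathcal{P})$ and their inverses; $\mathsf{all}(S,\mathcal{P})$ the set of all separations in $S$ that are nested with every separation in $S$. With $(R,\mathcal{P})$ the reduction of $(S,\mathcal{P})$, let $\mathsf{ext_r}(S,\mathcal{P})=\mathsf{ext}(R,\mathcal{P})$, $\mathsf{loc_r}(S,\mathcal{P})=\mathsf{loc}(R,\mathcal{P})$, $\mathsf{all_r}(S,\mathcal{P})=\mathsf{all}(R,\mathcal{P})$. **Strategies.** A strategy is a map $\sigma:\mathbb{N}\to\{\mathsf{ext},\mathsf{loc},\mathsf{all},\mathsf{ext_r},\mathsf{loc_r},\mathsf{all_r}\}$ (with $0\in\mathbb{N}$) such that $\sigma(i)\in\{\mathsf{ext_r},\mathsf{loc_r},\mathsf{all_r}\}$ for infinitely many $i$. Let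 $\sigma^+(i)=\sigma(i+1)$, and let $r_\sigma$ be the least $r$ with $\sigma(r)\in\{\mathsf{ext_r},\mathsf{loc_r},\mathsf{all_r}\}$. For a nested separation system $N$, let $\mathcal{O}_N$ be the set of all consistent orientations of $N$; given $S$ and $\mathcal{P}$, for $O\in\mathcal{O}_N$ let $S_O$ be the set of separations in $S$ that split $O$ and $\mathcal{P}_O=\{P\in\mathcal{P}: P\cap N=O\}$. For a feasible task $(S,\mathcal{P})$ the set $N_\sigma(S,\mathcal{P})$ is defined by recursion on $|S|$ and, for fixed $|S|$, on $r_\sigma$: if $S=\emptyset$, then $N_\sigma(S,\mathcal{P})=\emptyset$. If $S\ne\emptyset$, $r_\sigma=0$ and the reduction $(R,\mathcal{P})$ of $(S,\mathcal{P})$ has $R\subsetneq S$, then $N_\sigma(S,\mathcal{P})=N_\sigma(R,\mathcal{P})$. In all other cases, with $N:=\sigma(0)(S,\mathcal{P})$, let $N_\sigma(S,\mathcal{P})=N\cup\bigcup_{O\in\mathcal{O}_N}N_{\sigma^+}(S_O,\mathcal{P}_O)$. **$k$-strategies.** A $k$-strategy is a $k$-tuple $\Sigma=(\sigma_1,\dots,\sigma_k)$ of strategies each with range in $\{\mathsf{ext_r},\mathsf{loc_r},\mathsf{all_r}\}$. For a set $\mathcal{P}$ of $k$-profiles and $1\le\ell\le k$ let $P_\ell=\{(A,B)\in P:|A\cap B|<\ell\}$ and $\mathcal{P}_\ell=\{P_\ell:P\in\mathcal{P}\}$. The set $N_\Sigma(G,\mathcal{P})$ determined by $\Sigma$ is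 defined recursively: for $k=1$, $N_\Sigma(G,\mathcal{P})=N_{\sigma_1}(S,\mathcal{P})$, where $S$ is the set of all proper separations of $G$ of order $<1$. For $k\ge2$ let $N=N_{(\sigma_1,\dots,\sigma_{k-1})}(G,\mathcal{P}_{k-1})$, let $S$ be the set of proper $(k-1)$-separations of $G$ that are nested with $N$, and put $N_\Sigma(G,\mathcal{P})=N\cup\bigcup_{O\in\mathcal{O}_N}N_{\sigma_k}(S_O,\mathcal{P}_O)$. (The recursion succeeding means in particular that the pairs to which $N_{\sigma_i}$ is applied are feasible tasks.) *)

theory Defs
  imports "Graph_Theory.Pair_Digraph"
begin

text \<open>
  A finite simple undirected graph is a \<^locale>\<open>pair_graph\<close>: a finite, loop-free digraph without
  multiple arcs whose arc set is symmetric, an edge \<open>uv\<close> being the two arcs \<open>(u,v)\<close> and \<open>(v,u)\<close>.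
\<close>

section \<open>Separations\<close>

type_synonym 'a sep = "'a set \<times> 'a set"

definition separation :: "'a pair_pre_digraph \<Rightarrow> 'a sep \<Rightarrow> bool" where
  "separation G s \<longleftrightarrow> (case s of (A, B) \<Rightarrow>
     A \<subseteq> pverts G \<and> B \<subseteq> pverts G \<and> A \<union> B = pverts G \<and>
     (\<forall>u \<in> A - B. \<forall>v \<in> B - A. (u, v) \<notin> parcs G))"

definition sep_order :: "'a sep \<Rightarrow> nat" where
  "sep_order s = card (fst s \<inter> snd s)"

definition sep_inv :: "'a sep \<Rightarrow> 'a sep" where
  "sep_inv s = (snd s, fst s)"

definition proper_sep :: "'a sep \<Rightarrow> bool" where
  "proper_sep s \<longleftrightarrow> \<not> fst s \<subseteq> snd s \<and> \<not> snd s \<subseteq> fst s"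

text \<open>This is not the componentwise order on pairs: the second component is reversed.\<close>

definition sep_le :: "'a sep \<Rightarrow> 'a sep \<Rightarrow> bool" where
  "sep_le s t \<longleftrightarrow> fst s \<subseteq> fst t \<and> snd t \<subseteq> snd s"

definition sep_comparable :: "'a sep \<Rightarrow> 'a sep \<Rightarrow> bool" where
  "sep_comparable s t \<longleftrightarrow> sep_le s t \<or> sep_le t s"

definition sep_nested :: "'a sep \<Rightarrow> 'a sep \<Rightarrow> bool" where
  "sep_nested s t \<longleftrightarrow> sep_comparable s t \<or> sep_comparable s (sep_inv t)"

abbreviation sep_cross :: "'a sep \<Rightarrow> 'a sep \<Rightarrow> bool" where
  "sep_cross s t \<equiv> \<not> sep_nested s t"

definition nested_with :: "'a sep \<Rightarrow> 'a sep set \<Rightarrow> bool" where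
  "nested_with s S \<longleftrightarrow> (\<forall>t \<in> S. sep_nested s t)"

definition nested_set :: "'a sep set \<Rightarrow> bool" where
  "nested_set S \<longleftrightarrow> (\<forall>s \<in> S. \<forall>t \<in> S. sep_nested s t)"

definition separation_system :: "'a pair_pre_digraph \<Rightarrow> 'a sep set \<Rightarrow> bool" where
  "separation_system G S \<longleftrightarrow> (\<forall>s \<in> S. separation G s) \<and> (\<forall>s \<in> S. sep_inv s \<in> S)"

definition proper_separation_system :: "'a pair_pre_digraph \<Rightarrow> 'a sep set \<Rightarrow> bool" where
  "proper_separation_system G S \<longleftrightarrow> separation_system G S \<and> (\<forall>s \<in> S. proper_sep s)"

definition antisymmetric :: "'a sep set \<Rightarrow> bool" where
  "antisymmetric P \<longleftrightarrow> (\<forall>s \<in> P. sep_inv s \<notin> P)"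

definition sep_maximal :: "'a sep \<Rightarrow> 'a sep set \<Rightarrow> bool" where
  "sep_maximal s S \<longleftrightarrow> s \<in> S \<and> (\<forall>t \<in> S. sep_le s t \<longrightarrow> t = s)"

section \<open>Profiles\<close>

definition consistent :: "'a pair_pre_digraph \<Rightarrow> 'a sep set \<Rightarrow> bool" where
  "consistent G P \<longleftrightarrow> (\<forall>s \<in> P. separation G s) \<and>
     (\<forall>s \<in> P. \<forall>t. separation G t \<and> sep_le t s \<longrightarrow> sep_inv t \<notin> P)"

definition profile :: "'a pair_pre_digraph \<Rightarrow> 'a sep set \<Rightarrow> bool" where
  "profile G P \<longleftrightarrow> consistent G P \<and>
     (\<forall>A B C D. (A, B) \<in> P \<and> (C, D) \<in> P \<longrightarrow> (B \<inter> D, A \<union> C) \<notin> P)"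

definition k_profile :: "'a pair_pre_digraph \<Rightarrow> nat \<Rightarrow> 'a sep set \<Rightarrow> bool" where
  "k_profile G k P \<longleftrightarrow> profile G P \<and> (\<forall>s \<in> P. sep_order s < k) \<and>
     (\<forall>s. separation G s \<and> sep_order s < k \<longrightarrow> (s \<in> P) \<noteq> (sep_inv s \<in> P))"

definition orients :: "'a sep set \<Rightarrow> 'a sep set \<Rightarrow> bool" where
  "orients P S \<longleftrightarrow> antisymmetric P \<and> (\<forall>s \<in> S. s \<in> P \<or> sep_inv s \<in> P \<inter> S)"

definition orientation_of :: "'a pair_pre_digraph \<Rightarrow> 'a sep set \<Rightarrow> 'a sep set \<Rightarrow> bool" where
  "orientation_of G S Q \<longleftrightarrow> (\<exists>P. (\<forall>s \<in> P. separation G s) \<and> orients P S \<and> Q = P \<inter> S)"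

definition distinguishes :: "'a sep \<Rightarrow> 'a sep set \<Rightarrow> 'a sep set \<Rightarrow> bool" where
  "distinguishes s P P' \<longleftrightarrow>
     s \<in> P - P' \<and> sep_inv s \<in> P' - P \<or> s \<in> P' - P \<and> sep_inv s \<in> P - P'"

definition set_distinguishes :: "'a sep set \<Rightarrow> 'a sep set set \<Rightarrow> bool" where
  "set_distinguishes S \<P> \<longleftrightarrow>
     (\<forall>P \<in> \<P>. \<forall>P' \<in> \<P>. P \<noteq> P' \<longrightarrow> (\<exists>s \<in> S. distinguishes s P P'))"

definition splits :: "'a pair_pre_digraph \<Rightarrow> 'a sep \<Rightarrow> 'a sep set \<Rightarrow> bool" where
  "splits G s Q \<longleftrightarrow> consistent G (insert s Q) \<and> consistent G (insert (sep_inv s) Q)"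

definition kappa :: "'a pair_pre_digraph \<Rightarrow> 'a sep set \<Rightarrow> 'a sep set \<Rightarrow> nat" where
  "kappa G P P' = (LEAST n. \<exists>s. separation G s \<and> distinguishes s P P' \<and> sep_order s = n)"

definition efficiently_distinguishes ::
    "'a pair_pre_digraph \<Rightarrow> 'a sep \<Rightarrow> 'a sep set \<Rightarrow> 'a sep set \<Rightarrow> bool" where
  "efficiently_distinguishes G s P P' \<longleftrightarrow>
     separation G s \<and> distinguishes s P P' \<and> sep_order s = kappa G P P'"

definition essential :: "'a pair_pre_digraph \<Rightarrow> 'a sep set set \<Rightarrow> 'a sep \<Rightarrow> bool" where
  "essential G \<P> s \<longleftrightarrow> (\<exists>P \<in> \<P>. \<exists>P' \<in> \<P>. efficiently_distinguishes G s P P')"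

section \<open>Tasks\<close>

definition task :: "'a pair_pre_digraph \<Rightarrow> 'a sep set \<Rightarrow> 'a sep set set \<Rightarrow> bool" where
  "task G S \<P> \<longleftrightarrow> proper_separation_system G S \<and> (\<forall>P \<in> \<P>. profile G P) \<and>
     (\<forall>P \<in> \<P>. orients P S) \<and> set_distinguishes S \<P>"

definition feasible_task :: "'a pair_pre_digraph \<Rightarrow> 'a sep set \<Rightarrow> 'a sep set set \<Rightarrow> bool" where
  "feasible_task G S \<P> \<longleftrightarrow> task G S \<P> \<and>
     (\<forall>A B C D. (A, B) \<in> S \<and> (C, D) \<in> S \<and> sep_cross (A, B) (C, D) \<longrightarrow>
       (\<forall>P \<in> \<P>. \<forall>P' \<in> \<P>. (A, B) \<in> P \<and> (C, D) \<in> P \<and> (B, A) \<in> P' \<and> (D, C) \<in> P' \<longrightarrow>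
         (\<exists>t \<in> P \<inter> S. sep_le (A \<union> C, B \<inter> D) t)))"

definition reduction :: "'a sep set \<Rightarrow> 'a sep set set \<Rightarrow> 'a sep set" where
  "reduction S \<P> = {s \<in> S. \<exists>P \<in> \<P>. \<exists>P' \<in> \<P>. distinguishes s P P'}"

section \<open>Operations\<close>

definition extremal :: "'a sep set \<Rightarrow> 'a sep \<Rightarrow> bool" where
  "extremal S s \<longleftrightarrow> s \<in> S \<and> (\<forall>t \<in> S. sep_le t s \<or> sep_le (sep_inv t) s)"

definition well_separated :: "'a sep set \<Rightarrow> 'a sep set \<Rightarrow> bool" where
  "well_separated S P \<longleftrightarrow> nested_set {s. sep_maximal s (P \<inter> S)}"

definition locally_maximal :: "'a sep set \<Rightarrow> 'a sep set set \<Rightarrow> 'a sep \<Rightarrow> bool" where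
  "locally_maximal S \<P> s \<longleftrightarrow> (\<exists>P \<in> \<P>. well_separated S P \<and> sep_maximal s (P \<inter> S))"

definition ext :: "'a sep set \<Rightarrow> 'a sep set set \<Rightarrow> 'a sep set" where
  "ext S \<P> = {s. extremal S s} \<union> sep_inv ` {s. extremal S s}"

definition loc :: "'a sep set \<Rightarrow> 'a sep set set \<Rightarrow> 'a sep set" where
  "loc S \<P> = {s. locally_maximal S \<P> s} \<union> sep_inv ` {s. locally_maximal S \<P> s}"

definition all_nested :: "'a sep set \<Rightarrow> 'a sep set set \<Rightarrow> 'a sep set" where
  "all_nested S \<P> = {s \<in> S. nested_with s S}"

datatype operation = Ext | Loc | AllNested | ExtR | LocR | AllNestedR

fun apply_op :: "operation \<Rightarrow> 'a sep set \<Rightarrow> 'a sep set set \<Rightarrow> 'a sep set" where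
  "apply_op Ext S \<P> = ext S \<P>"
| "apply_op Loc S \<P> = loc S \<P>"
| "apply_op AllNested S \<P> = all_nested S \<P>"
| "apply_op ExtR S \<P> = ext (reduction S \<P>) \<P>"
| "apply_op LocR S \<P> = loc (reduction S \<P>) \<P>"
| "apply_op AllNestedR S \<P> = all_nested (reduction S \<P>) \<P>"

section \<open>Strategies\<close>

definition reducing_ops :: "operation set" where
  "reducing_ops = {ExtR, LocR, AllNestedR}"

definition strategy :: "(nat \<Rightarrow> operation) \<Rightarrow> bool" where
  "strategy \<sigma> \<longleftrightarrow> infinite {i. \<sigma> i \<in> reducing_ops}"

definition shift :: "(nat \<Rightarrow> operation) \<Rightarrow> nat \<Rightarrow> operation" where
  "shift \<sigma> i = \<sigma> (Suc i)"

definition r_index :: "(nat \<Rightarrow> operation) \<Rightarrow> nat" where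
  "r_index \<sigma> = (LEAST r. \<sigma> r \<in> reducing_ops)"

definition consistent_orientations :: "'a pair_pre_digraph \<Rightarrow> 'a sep set \<Rightarrow> 'a sep set set" where
  "consistent_orientations G N = {Q. orientation_of G N Q \<and> consistent G Q}"

definition seps_splitting :: "'a pair_pre_digraph \<Rightarrow> 'a sep set \<Rightarrow> 'a sep set \<Rightarrow> 'a sep set" where
  "seps_splitting G S Q = {s \<in> S. splits G s Q}"

definition profiles_inducing :: "'a sep set set \<Rightarrow> 'a sep set \<Rightarrow> 'a sep set \<Rightarrow> 'a sep set set" where
  "profiles_inducing \<P> N Q = {P \<in> \<P>. P \<inter> N = Q}"

text \<open>
  \<open>strategy_eval G \<sigma> S \<P> N\<close> says that the recursion for \<open>N\<^sub>\<sigma>(S,\<P>)\<close> terminates with value \<open>N\<close>, and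
  that on the way it is only ever called on feasible tasks and only ever forms the consistent
  orientations of nested separation systems. The recursion is partial, hence a relation;
  \<open>M Q\<close> is the value returned by the recursive call for the orientation \<open>Q\<close>.
\<close>

inductive strategy_eval ::
    "'a pair_pre_digraph \<Rightarrow> (nat \<Rightarrow> operation) \<Rightarrow> 'a sep set \<Rightarrow> 'a sep set set \<Rightarrow> 'a sep set \<Rightarrow> bool"
  for G where
  empty:
    "feasible_task G {} \<P> \<Longrightarrow> strategy_eval G \<sigma> {} \<P> {}"
| reduce:
    "\<lbrakk>feasible_task G S \<P>; S \<noteq> {}; r_index \<sigma> = 0; reduction S \<P> \<subset> S;
      strategy_eval G \<sigma> (reduction S \<P>) \<P> N\<rbrakk>
     \<Longrightarrow> strategy_eval G \<sigma> S \<P> N"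
| split:
    "\<lbrakk>feasible_task G S \<P>; S \<noteq> {}; \<not> (r_index \<sigma> = 0 \<and> reduction S \<P> \<subset> S);
      N = apply_op (\<sigma> 0) S \<P>; separation_system G N; nested_set N;
      \<And>Q. Q \<in> consistent_orientations G N \<Longrightarrow>
        strategy_eval G (shift \<sigma>) (seps_splitting G S Q) (profiles_inducing \<P> N Q) (M Q)\<rbrakk>
     \<Longrightarrow> strategy_eval G \<sigma> S \<P> (N \<union> (\<Union>Q \<in> consistent_orientations G N. M Q))"

section \<open>k-strategies\<close>

text \<open>A \<open>k\<close>-strategy \<open>(\<sigma>\<^sub>1, \<dots>, \<sigma>\<^sub>k)\<close> is a list of length \<open>k\<close>.\<close>

definition k_strategy :: "nat \<Rightarrow> (nat \<Rightarrow> operation) list \<Rightarrow> bool" where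
  "k_strategy k \<Sigma> \<longleftrightarrow> length \<Sigma> = k \<and> (\<forall>\<sigma> \<in> set \<Sigma>. strategy \<sigma> \<and> range \<sigma> \<subseteq> reducing_ops)"

definition truncate_profile :: "nat \<Rightarrow> 'a sep set \<Rightarrow> 'a sep set" where
  "truncate_profile l P = {s \<in> P. sep_order s < l}"

text \<open>
  \<open>k_strategy_eval G \<Sigma> \<P> N\<close> says that the recursion for \<open>N\<^sub>\<Sigma>(G,\<P>)\<close> succeeds with value \<open>N\<close>.
  In the second rule \<open>k\<close> is \<open>length \<Sigma> + 1\<close>, so that \<open>length \<Sigma>\<close> is \<open>k - 1\<close>.
\<close>

inductive k_strategy_eval ::
    "'a pair_pre_digraph \<Rightarrow> (nat \<Rightarrow> operation) list \<Rightarrow> 'a sep set set \<Rightarrow> 'a sep set \<Rightarrow> bool"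
  for G where
  single:
    "strategy_eval G \<sigma> {s. separation G s \<and> proper_sep s \<and> sep_order s < 1} \<P> N
     \<Longrightarrow> k_strategy_eval G [\<sigma>] \<P> N"
| snoc:
    "\<lbrakk>\<Sigma> \<noteq> []; k_strategy_eval G \<Sigma> (truncate_profile (length \<Sigma>) ` \<P>) N;
      separation_system G N; nested_set N;
      S = {s. separation G s \<and> proper_sep s \<and> sep_order s = length \<Sigma> \<and> nested_with s N};
      \<And>Q. Q \<in> consistent_orientations G N \<Longrightarrow>
        strategy_eval G \<sigma> (seps_splitting G S Q) (profiles_inducing \<P> N Q) (M Q)\<rbrakk>
     \<Longrightarrow> k_strategy_eval G (\<Sigma> @ [\<sigma>]) \<P> (N \<union> (\<Union>Q \<in> consistent_orientations G N. M Q))"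

text \<open>Meaningful only where \<^const>\<open>k_strategy_eval\<close> has exactly one value.\<close>

definition N_Sigma ::
    "'a pair_pre_digraph \<Rightarrow> (nat \<Rightarrow> operation) list \<Rightarrow> 'a sep set set \<Rightarrow> 'a sep set" where
  "N_Sigma G \<Sigma> \<P> = (THE N. k_strategy_eval G \<Sigma> \<P> N)"

section \<open>Isomorphisms\<close>

definition graph_isomorphism ::
    "('a \<Rightarrow> 'b) \<Rightarrow> 'a pair_pre_digraph \<Rightarrow> 'b pair_pre_digraph \<Rightarrow> bool" where
  "graph_isomorphism f G H \<longleftrightarrow> bij_betw f (pverts G) (pverts H) \<and>
     (\<forall>u \<in> pverts G. \<forall>v \<in> pverts G. (u, v) \<in> parcs G \<longleftrightarrow> (f u, f v) \<in> parcs H)"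

definition map_sep :: "('a \<Rightarrow> 'b) \<Rightarrow> 'a sep \<Rightarrow> 'b sep" where
  "map_sep f = map_prod (image f) (image f)"

end

theory Submission
  imports Defs
begin

text \<open>
  Every operation in a \<open>k\<close>-strategy reduces first, so it is applied only to tasks in which each
  separation distinguishes two profiles. In such a task, if nonempty, feasibility makes the maximal
  separations extremal; hence each operation returns a nonempty set of separations nested with all of
  \<open>S\<close>, the sets \<open>S\<^sub>O\<close> are smaller than \<open>S\<close> and again yield feasible tasks, and separations splitting
  different orientations are automatically nested.

  Raising \<open>k\<close> requires that two profiles that agree below order \<open>k - 1\<close> are distinguished by a
  \<open>(k - 1)\<close>-separation nested with the set \<open>N\<close> already found. One that crosses as few elements of \<open>N\<close>
  as possible will do: were it to cross some element of \<open>N\<close>, one of its corners with that element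
  would also distinguish the profiles and would cross fewer.

  Canonicity holds because an isomorphism of graphs carries derivations of the recursion to
  derivations, and the value of the recursion is unique.
\<close>

section \<open>The partial order of separations\<close>

text \<open>What must survive when a task is cut down is decided by one criterion: a subsystem
  closed under inverses again gives a feasible task if it keeps every separation of \<open>S\<close>
  that two of the remaining profiles orient oppositely. This works because the upper bound supplied
  by feasibility for \<open>s\<close> and \<open>t\<close> is itself oriented oppositely by the same
  two profiles. The reduction keeps such separations by definition; \<open>S\<^sub>O\<close> keeps
  them because a separation that distinguishes two consistent sets containing \<open>O\<close>
  splits \<open>O\<close>. Efficiency comes from the order of treatment. The profiles compared at
  order \<open>l\<close> agree on everything of smaller order, so an \<open>l\<close>-separation
  that distinguishes them does so efficiently, and a corner of order at most \<open>l\<close> that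
  distinguishes them has order exactly \<open>l\<close>. The latter fact keeps the crossing argument
  inside one order and yields feasibility there. Essentiality of the sets already built is needed in
  turn: it is what bounds the order of one of the corners.\<close>

definition sep_sup :: "'a sep \<Rightarrow> 'a sep \<Rightarrow> 'a sep" where
  "sep_sup s t = (fst s \<union> fst t, snd s \<inter> snd t)"

lemma sep_inv_inv [simp]: "sep_inv (sep_inv s) = s"
  by (simp add: sep_inv_def)

lemma sep_order_inv [simp]: "sep_order (sep_inv s) = sep_order s"
  by (simp add: sep_order_def sep_inv_def Int_commute)

lemma proper_sep_inv [simp]: "proper_sep (sep_inv s) \<longleftrightarrow> proper_sep s"
  by (auto simp: proper_sep_def sep_inv_def)

lemma sep_le_refl [simp]: "sep_le s s"
  by (simp add: sep_le_def)

lemma sep_le_trans [trans]: "sep_le s t \<Longrightarrow> sep_le t u \<Longrightarrow> sep_le s u"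
  by (auto simp: sep_le_def)

lemma sep_le_antisym: "sep_le s t \<Longrightarrow> sep_le t s \<Longrightarrow> s = t"
  by (auto simp: sep_le_def prod_eq_iff)

lemma sep_le_inv_inv [simp]: "sep_le (sep_inv s) (sep_inv t) \<longleftrightarrow> sep_le t s"
  by (auto simp: sep_le_def sep_inv_def)

lemma sep_le_inv_swap: "sep_le s (sep_inv t) \<longleftrightarrow> sep_le t (sep_inv s)"
  by (auto simp: sep_le_def sep_inv_def)

lemma sep_inv_le_swap: "sep_le (sep_inv s) t \<longleftrightarrow> sep_le (sep_inv t) s"
  by (auto simp: sep_le_def sep_inv_def)

lemma sep_le_sup1: "sep_le s (sep_sup s t)"
  and sep_le_sup2: "sep_le t (sep_sup s t)"
  by (auto simp: sep_le_def sep_sup_def)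

lemma sep_sup_least: "sep_le s u \<Longrightarrow> sep_le t u \<Longrightarrow> sep_le (sep_sup s t) u"
  by (auto simp: sep_le_def sep_sup_def)

lemma sep_nested_iff:
  "sep_nested s t \<longleftrightarrow>
    sep_le s t \<or> sep_le t s \<or> sep_le s (sep_inv t) \<or> sep_le (sep_inv t) s"
  by (auto simp: sep_nested_def sep_comparable_def)

lemma sep_nested_refl [simp]: "sep_nested s s"
  by (simp add: sep_nested_iff)

lemma sep_nested_inv2 [simp]: "sep_nested s (sep_inv t) \<longleftrightarrow> sep_nested s t"
  by (auto simp: sep_nested_iff)

lemma sep_nested_sym: "sep_nested s t \<longleftrightarrow> sep_nested t s"
  by (auto simp: sep_nested_iff sep_le_inv_swap[of t] sep_inv_le_swap[of t])

lemma sep_nested_inv1 [simp]: "sep_nested (sep_inv s) t \<longleftrightarrow> sep_nested s t"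
  by (metis sep_nested_inv2 sep_nested_sym)

lemma nested_with_inv [simp]: "nested_with (sep_inv s) S \<longleftrightarrow> nested_with s S"
  by (simp add: nested_with_def)


text \<open>If \<open>s \<le> u\<close> and \<open>t \<le> sep_inv u\<close> then \<open>s \<le> u \<le> sep_inv t\<close>, so crossing leaves only the cases
  in which \<open>u\<close> or its inverse bounds both, or is bounded by one of the two.\<close>

lemma cross_nested_sup:
  assumes "sep_cross s t" "sep_nested u s" "sep_nested u t"
  shows "sep_nested u (sep_sup s t)"
proof -
  have s: "sep_le u s \<or> sep_le s u \<or> sep_le s (sep_inv u) \<or> sep_le (sep_inv u) s"
    using assms(2) by (auto simp: sep_nested_iff sep_le_inv_swap[of u] sep_inv_le_swap[of u])
  have t: "sep_le u t \<or> sep_le t u \<or> sep_le t (sep_inv u) \<or> sep_le (sep_inv u) t"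
    using assms(3) by (auto simp: sep_nested_iff sep_le_inv_swap[of u] sep_inv_le_swap[of u])
  have not: "\<not> (sep_le s u \<and> sep_le t (sep_inv u))"
    using assms(1) sep_le_trans[of s u "sep_inv t"] by (auto simp: sep_nested_iff sep_le_inv_swap[of t])
  have not': "\<not> (sep_le s (sep_inv u) \<and> sep_le t u)"
    using assms(1) sep_le_trans[of s "sep_inv u" "sep_inv t"] by (auto simp: sep_nested_iff)
  consider "sep_le u (sep_sup s t)" | "sep_le (sep_inv u) (sep_sup s t)"
    | "sep_le (sep_sup s t) u" | "sep_le (sep_sup s t) (sep_inv u)"
    using s t not not' sep_sup_least sep_le_trans[OF _ sep_le_sup1] sep_le_trans[OF _ sep_le_sup2]
    by metis
  then show ?thesis
    by cases (simp_all add: sep_nested_iff sep_le_inv_swap[of u] sep_inv_le_swap[of u])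
qed

text \<open>Lets a corner of two crossing separations stay among those nested with the set built for
  smaller orders.\<close>

lemma cross_nested_with_sup:
  assumes "sep_cross s t" "nested_with s N" "nested_with t N"
  shows "nested_with (sep_sup s t) N"
  unfolding nested_with_def
proof
  fix u assume "u \<in> N"
  then show "sep_nested (sep_sup s t) u"
    using assms cross_nested_sup[of s t u] sep_nested_sym unfolding nested_with_def by blast
qed

context pair_graph
begin

section \<open>Inverses, corners and their orders\<close>

lemma separation_inv [simp]: "separation G (sep_inv s) \<longleftrightarrow> separation G s"
proof -
  have "separation G (sep_inv t)" if t: "separation G t" for t
  proof -
    have "(u, v) \<notin> parcs G" if "u \<in> snd t - fst t" "v \<in> fst t - snd t" for u v
      using t that arcs_symmetric[of u v] unfolding separation_def by (cases t) auto
    then show ?thesis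
      using t unfolding separation_def sep_inv_def by (cases t) auto
  qed
  then show ?thesis by (metis sep_inv_inv)
qed

lemma separation_sup: "separation G s \<Longrightarrow> separation G t \<Longrightarrow> separation G (sep_sup s t)"
  by (cases s; cases t; simp add: separation_def sep_sup_def) blast

lemma finite_separations: "finite {s. separation G s}"
proof (rule finite_subset)
  show "{s. separation G s} \<subseteq> Pow (pverts G) \<times> Pow (pverts G)"
    by (auto simp: separation_def)
  show "finite (Pow (pverts G) \<times> Pow (pverts G))" by simp
qed

text \<open>An equality, not only submodularity: as the sides of each separation cover the vertex
  set, the separators of the two opposite corners have the same union and the same intersection as
  those of \<open>s\<close> and \<open>t\<close>.\<close>

lemma sep_order_sup_add:
  assumes "separation G s" "separation G t"
  shows "sep_order (sep_sup s t) + sep_order (sep_sup (sep_inv s) (sep_inv t))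
    = sep_order s + sep_order t"
proof -
  obtain A B C D where st: "s = (A, B)" "t = (C, D)" by (metis surj_pair)
  have sub: "A \<union> B = pverts G" "C \<union> D = pverts G"
    using assms unfolding separation_def st by auto
  then have fin: "finite A" "finite B" "finite C" "finite D"
    using finite_verts by (simp_all, metis finite_Un sub)+
  have "card (A \<inter> B) + card (C \<inter> D)
      = card (A \<inter> B \<union> C \<inter> D) + card (A \<inter> B \<inter> (C \<inter> D))"
    using fin by (intro card_Un_Int) auto
  moreover have "card ((A \<union> C) \<inter> (B \<inter> D)) + card ((B \<union> D) \<inter> (A \<inter> C))
      = card ((A \<union> C) \<inter> (B \<inter> D) \<union> (B \<union> D) \<inter> (A \<inter> C))
        + card ((A \<union> C) \<inter> (B \<inter> D) \<inter> ((B \<union> D) \<inter> (A \<inter> C)))"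
    using fin by (intro card_Un_Int) auto
  moreover have "(A \<union> C) \<inter> (B \<inter> D) \<union> (B \<union> D) \<inter> (A \<inter> C) = A \<inter> B \<union> C \<inter> D"
    using sub by auto
  moreover have "(A \<union> C) \<inter> (B \<inter> D) \<inter> ((B \<union> D) \<inter> (A \<inter> C)) = A \<inter> B \<inter> (C \<inter> D)" by auto
  ultimately show ?thesis
    by (simp add: st sep_order_def sep_sup_def sep_inv_def)
qed

text \<open>\<open>(A, B)\<close> lies below \<open>(B, A)\<close> exactly when
  \<open>A \<subseteq> B\<close>. Expressed through order and inversion, properness can be read off
  from consistency and carried along isomorphisms.\<close>

lemma proper_sep_iff:
  shows "proper_sep s \<longleftrightarrow> \<not> sep_le s (sep_inv s) \<and> \<not> sep_le (sep_inv s) s"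
  by (auto simp: proper_sep_def sep_le_def sep_inv_def)

section \<open>Consistency and profiles\<close>

text \<open>With the smaller separation replaced by its inverse, the condition concerns only pairs
  inside \<open>P\<close>: no element lies above the inverse of an element. This form is convenient
  for images and for sets with one element inserted.\<close>

lemma consistent_iff:
  "consistent G P \<longleftrightarrow>
    (\<forall>s \<in> P. separation G s) \<and> (\<forall>s \<in> P. \<forall>t \<in> P. \<not> sep_le (sep_inv t) s)"
  unfolding consistent_def by (metis separation_inv sep_inv_inv)

lemma consistent_subset: "consistent G P \<Longrightarrow> Q \<subseteq> P \<Longrightarrow> consistent G Q"
  unfolding consistent_def by blast

lemma consistent_antisym: "consistent G P \<Longrightarrow> s \<in> P \<Longrightarrow> sep_inv s \<notin> P"
  unfolding consistent_def by (metis sep_le_refl)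

lemma consistent_le:
  assumes "consistent G P" "t \<in> P" "sep_le s t"
  shows "sep_inv s \<notin> P"
  using assms unfolding consistent_iff by (metis sep_inv_inv)

text \<open>Oriented both ways by consistent sets, \<open>s\<close> can lie neither below nor above
  its inverse. This supplies properness for corners that have to be placed in a proper
  system.\<close>

lemma consistent_proper:
  assumes "consistent G P" "s \<in> P" "consistent G P'" "sep_inv s \<in> P'"
  shows "proper_sep s"
  using consistent_le[OF assms(1,2), of "sep_inv s"] consistent_le[OF assms(3,4), of s] assms(2,4)
  by (auto simp: proper_sep_iff)

lemma distinguishes_iff:
  assumes "consistent G P" "consistent G P'"
  shows "distinguishes s P P' \<longleftrightarrow> s \<in> P \<and> sep_inv s \<in> P' \<or> s \<in> P' \<and> sep_inv s \<in> P"
  unfolding distinguishes_def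
  using consistent_antisym[OF assms(1)] consistent_antisym[OF assms(2)]
  by (metis Diff_iff sep_inv_inv)

lemma profile_consistent: "profile G P \<Longrightarrow> consistent G P"
  by (simp add: profile_def)

lemma profile_sup_inv: "profile G P \<Longrightarrow> s \<in> P \<Longrightarrow> t \<in> P \<Longrightarrow> sep_inv (sep_sup s t) \<notin> P"
  unfolding profile_def sep_sup_def sep_inv_def by (cases s; cases t) auto

lemma k_profile_consistent: "k_profile G k P \<Longrightarrow> consistent G P"
  by (simp add: k_profile_def profile_def)

lemma k_profile_cases:
  assumes "k_profile G k P" "separation G s" "sep_order s < k"
  obtains "s \<in> P" | "sep_inv s \<in> P"
  using assms unfolding k_profile_def by blast

text \<open>The profile property only forbids the inverse of the join; the order bound, by which one
  of the two must be present, puts the join itself into \<open>P\<close>.\<close>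

lemma k_profile_sup:
  assumes "k_profile G k P" "s \<in> P" "t \<in> P" "sep_order (sep_sup s t) < k"
  shows "sep_sup s t \<in> P"
proof -
  have "separation G (sep_sup s t)"
    using assms k_profile_consistent consistent_iff separation_sup by metis
  moreover have "sep_inv (sep_sup s t) \<notin> P"
    using assms profile_sup_inv unfolding k_profile_def by blast
  ultimately show ?thesis
    using assms(1,4) k_profile_cases by blast
qed

lemma k_profile_le:
  assumes "k_profile G k P" "t \<in> P" "separation G s" "sep_le s t" "sep_order s < k"
  shows "s \<in> P"
  using consistent_le[OF k_profile_consistent[OF assms(1)] assms(2,4)]
    k_profile_cases[OF assms(1,3,5)] by blast

lemma k_profile_truncate:
  assumes "k_profile G k P" "l \<le> k"
  shows "k_profile G l (truncate_profile l P)"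
proof -
  have sub: "truncate_profile l P \<subseteq> P"
    by (auto simp: truncate_profile_def)
  have "consistent G (truncate_profile l P)"
    using consistent_subset[OF k_profile_consistent[OF assms(1)] sub] .
  moreover have "(B \<inter> D, A \<union> C) \<notin> truncate_profile l P"
    if "(A, B) \<in> truncate_profile l P" "(C, D) \<in> truncate_profile l P" for A B C D
    using that assms(1) sub unfolding k_profile_def profile_def by blast
  ultimately have "profile G (truncate_profile l P)"
    unfolding profile_def by blast
  moreover have "(s \<in> truncate_profile l P) \<noteq> (sep_inv s \<in> truncate_profile l P)"
    if "separation G s" "sep_order s < l" for s
  proof -
    have "(s \<in> P) \<noteq> (sep_inv s \<in> P)"
      using assms that unfolding k_profile_def by (meson order_less_le_trans)
    then show ?thesis
      using that by (auto simp: truncate_profile_def)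
  qed
  moreover have "sep_order s < l" if "s \<in> truncate_profile l P" for s
    using that by (simp add: truncate_profile_def)
  ultimately show ?thesis
    unfolding k_profile_def by blast
qed

end

section \<open>Feasible tasks\<close>

lemma exists_sep_maximal:
  assumes "finite S" "s \<in> S"
  obtains m where "sep_maximal m S" "sep_le s m"
proof -
  interpret ord: order sep_le "\<lambda>s t. sep_le s t \<and> s \<noteq> t"
    by unfold_locales (use sep_le_antisym sep_le_trans sep_le_refl in blast)+
  show ?thesis
    using ord.finite_has_maximal2[OF assms] that unfolding sep_maximal_def by metis
qed

lemma feasible_task_separation: "feasible_task G S \<P> \<Longrightarrow> s \<in> S \<Longrightarrow> separation G s"
  and feasible_task_inv: "feasible_task G S \<P> \<Longrightarrow> s \<in> S \<Longrightarrow> sep_inv s \<in> S"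
  and feasible_task_proper: "feasible_task G S \<P> \<Longrightarrow> s \<in> S \<Longrightarrow> proper_sep s"
  and feasible_task_profile: "feasible_task G S \<P> \<Longrightarrow> P \<in> \<P> \<Longrightarrow> profile G P"
  and feasible_task_consistent: "feasible_task G S \<P> \<Longrightarrow> P \<in> \<P> \<Longrightarrow> consistent G P"
  unfolding feasible_task_def task_def proper_separation_system_def separation_system_def
    profile_def by blast+

lemma feasible_task_orients:
  "feasible_task G S \<P> \<Longrightarrow> P \<in> \<P> \<Longrightarrow> s \<in> S \<Longrightarrow> s \<in> P \<or> sep_inv s \<in> P"
  unfolding feasible_task_def task_def orients_def by blast

lemma feasible_task_sup:
  assumes "feasible_task G S \<P>" "s \<in> S" "t \<in> S" "sep_cross s t" "P \<in> \<P>" "P' \<in> \<P>"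
    and "s \<in> P" "t \<in> P" "sep_inv s \<in> P'" "sep_inv t \<in> P'"
  obtains u where "u \<in> P" "u \<in> S" "sep_le (sep_sup s t) u"
  using assms unfolding feasible_task_def sep_sup_def sep_inv_def
  by (cases s; cases t) (simp, blast)

lemma feasible_task_distinguishes:
  "feasible_task G S \<P> \<Longrightarrow> P \<in> \<P> \<Longrightarrow> P' \<in> \<P> \<Longrightarrow> P \<noteq> P' \<Longrightarrow> \<exists>s \<in> S. distinguishes s P P'"
  by (simp add: feasible_task_def task_def set_distinguishes_def)

context pair_graph
begin

lemma feasible_task_finite: "feasible_task G S \<P> \<Longrightarrow> finite S"
  using feasible_task_separation finite_separations by (metis finite_subset mem_Collect_eq subsetI)

lemma feasible_taskI:
  assumes "\<And>s. s \<in> S \<Longrightarrow> separation G s" "\<And>s. s \<in> S \<Longrightarrow> sep_inv s \<in> S"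
    and "\<And>s. s \<in> S \<Longrightarrow> proper_sep s"
    and profile: "\<And>P. P \<in> \<P> \<Longrightarrow> profile G P"
    and or: "\<And>P s. P \<in> \<P> \<Longrightarrow> s \<in> S \<Longrightarrow> s \<in> P \<or> sep_inv s \<in> P"
    and dist: "\<And>P P'. P \<in> \<P> \<Longrightarrow> P' \<in> \<P> \<Longrightarrow> P \<noteq> P' \<Longrightarrow> \<exists>s \<in> S. distinguishes s P P'"
    and sup: "\<And>P P' s t. P \<in> \<P> \<Longrightarrow> P' \<in> \<P> \<Longrightarrow> s \<in> S \<Longrightarrow> t \<in> S \<Longrightarrow> sep_cross s t \<Longrightarrow>
      s \<in> P \<Longrightarrow> t \<in> P \<Longrightarrow> sep_inv s \<in> P' \<Longrightarrow> sep_inv t \<in> P' \<Longrightarrow>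
      \<exists>u \<in> P \<inter> S. sep_le (sep_sup s t) u"
  shows "feasible_task G S \<P>"
proof -
  have "antisymmetric P" if "P \<in> \<P>" for P
    using consistent_antisym[OF profile_consistent[OF profile[OF that]]]
    by (auto simp: antisymmetric_def)
  then have "task G S \<P>"
    using assms(1-3) profile or dist
    unfolding task_def proper_separation_system_def separation_system_def orients_def
      set_distinguishes_def by blast
  then show ?thesis
    unfolding feasible_task_def using sup[unfolded sep_sup_def sep_inv_def] by fastforce
qed

text \<open>The bound \<open>u\<close> found in \<open>S\<close> lies above \<open>s\<close>, so a
  profile containing \<open>sep_inv s\<close> must contain \<open>sep_inv u\<close>. Hence
  \<open>P\<close> and \<open>P'\<close> orient \<open>u\<close> oppositely and \<open>keep\<close>
  applies to it.\<close>

lemma feasible_task_restrict: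
  assumes f: "feasible_task G S \<P>" and "\<P>' \<subseteq> \<P>" "S' \<subseteq> S" "\<And>s. s \<in> S' \<Longrightarrow> sep_inv s \<in> S'"
    and keep: "\<And>P P' s. P \<in> \<P>' \<Longrightarrow> P' \<in> \<P>' \<Longrightarrow> s \<in> S \<Longrightarrow> s \<in> P \<Longrightarrow> sep_inv s \<in> P' \<Longrightarrow> s \<in> S'"
  shows "feasible_task G S' \<P>'"
proof (rule feasible_taskI)
  show "separation G s" "proper_sep s" if "s \<in> S'" for s
    using that assms(3) feasible_task_separation[OF f] feasible_task_proper[OF f] by blast+
  show "sep_inv s \<in> S'" if "s \<in> S'" for s
    using that assms(4) by blast
  show "profile G P" if "P \<in> \<P>'" for P
    using that assms(2) feasible_task_profile[OF f] by blast
  show "s \<in> P \<or> sep_inv s \<in> P" if "P \<in> \<P>'" "s \<in> S'" for P s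
    using that assms(2,3) feasible_task_orients[OF f] by blast
next
  fix P P' assume P: "P \<in> \<P>'" "P' \<in> \<P>'" "P \<noteq> P'"
  then obtain s where s: "s \<in> S" "distinguishes s P P'"
    using feasible_task_distinguishes[OF f] assms(2) by blast
  then show "\<exists>s \<in> S'. distinguishes s P P'"
    using keep[of P P' s] keep[of P' P s] P unfolding distinguishes_def by blast
next
  fix P P' s t
  assume P: "P \<in> \<P>'" "P' \<in> \<P>'" and st: "s \<in> S'" "t \<in> S'" "sep_cross s t"
    and o: "s \<in> P" "t \<in> P" "sep_inv s \<in> P'" "sep_inv t \<in> P'"
  obtain u where u: "u \<in> P" "u \<in> S" "sep_le (sep_sup s t) u"
    using feasible_task_sup[OF f _ _ st(3) _ _ o] P st assms(2,3) by blast
  have "sep_le s u"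
    using u(3) sep_le_sup1 sep_le_trans by blast
  then have "u \<notin> P'"
    using consistent_le feasible_task_consistent[OF f] P(2) o(3) assms(2) by blast
  then have "sep_inv u \<in> P'"
    using feasible_task_orients[OF f] P(2) u(2) assms(2) by blast
  then show "\<exists>u \<in> P \<inter> S'. sep_le (sep_sup s t) u"
    using keep[OF P u(2,1)] u by blast
qed

lemma reduction_iff:
  assumes "feasible_task G S \<P>"
  shows "s \<in> reduction S \<P> \<longleftrightarrow> s \<in> S \<and> (\<exists>P \<in> \<P>. \<exists>P' \<in> \<P>. s \<in> P \<and> sep_inv s \<in> P')"
  using assms distinguishes_iff feasible_task_consistent unfolding reduction_def
  by (smt (verit, ccfv_threshold) mem_Collect_eq)

lemma feasible_task_reduction:
  assumes "feasible_task G S \<P>"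
  shows "feasible_task G (reduction S \<P>) \<P>"
proof (rule feasible_task_restrict[OF assms])
  show "sep_inv s \<in> reduction S \<P>" if "s \<in> reduction S \<P>" for s
    using that feasible_task_inv[OF assms] unfolding reduction_iff[OF assms] by auto
qed (auto simp: reduction_iff[OF assms])

lemma reduction_idem: "reduction (reduction S \<P>) \<P> = reduction S \<P>"
  by (auto simp: reduction_def)

section \<open>The operations on reduced tasks\<close>

text \<open>A bound in \<open>S\<close> above the join of \<open>s\<close> with something else must
  be \<open>s\<close> again, by maximality. So \<open>s\<close> is nested with whatever two profiles
  orient oppositely in parallel with \<open>s\<close>; reducedness extends this to all of
  \<open>S\<close>. Maximality then turns the comparabilities with \<open>s\<close> below into
  equalities.\<close>

lemma maximal_extremal:
  assumes f: "feasible_task G S \<P>" and red: "reduction S \<P> = S" and s: "sep_maximal s S"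
  shows "extremal S s"
  unfolding extremal_def
proof (intro conjI ballI)
  show sS: "s \<in> S"
    using s by (simp add: sep_maximal_def)
  fix t assume t: "t \<in> S"
  have key: "sep_nested s u"
    if u: "u \<in> S" "P \<in> \<P>" "P' \<in> \<P>" "s \<in> P" "u \<in> P" "sep_inv s \<in> P'" "sep_inv u \<in> P'" for u P P'
  proof (rule ccontr)
    assume "sep_cross s u"
    then obtain v where v: "v \<in> S" "sep_le (sep_sup s u) v"
      using feasible_task_sup[OF f sS u(1) _ u(2-7)] by blast
    then have "v = s"
      using s sep_le_trans[OF sep_le_sup1] unfolding sep_maximal_def by blast
    then have "sep_le u s"
      using v(2) sep_le_trans[OF sep_le_sup2] by blast
    with \<open>sep_cross s u\<close> show False
      by (simp add: sep_nested_iff)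
  qed
  have "sep_nested s t"
  proof (rule ccontr)
    assume cross: "sep_cross s t"
    have no1: False if "P \<in> \<P>" "P' \<in> \<P>" "s \<in> P" "t \<in> P" "sep_inv s \<in> P'" "sep_inv t \<in> P'" for P P'
      using key[OF t that] cross by blast
    have no2: False if "P \<in> \<P>" "P' \<in> \<P>" "s \<in> P" "sep_inv t \<in> P" "sep_inv s \<in> P'" "t \<in> P'" for P P'
      using key[OF feasible_task_inv[OF f t] that(1-5)] that cross by simp
    have ors: "s \<in> P \<or> sep_inv s \<in> P" and ort: "t \<in> P \<or> sep_inv t \<in> P" if "P \<in> \<P>" for P
      using feasible_task_orients[OF f that] sS t by blast+
    \<comment> \<open>Each profile orients \<open>s\<close> and \<open>t\<close> in one of four
      ways, and no two opposite ways both occur. As each of \<open>s\<close>, \<open>t\<close> and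
      their inverses lies in some profile, the ways that occur must include an opposite
      pair.\<close>
    obtain P P' Q Q' where "P \<in> \<P>" "P' \<in> \<P>" "s \<in> P" "sep_inv s \<in> P'"
      "Q \<in> \<P>" "Q' \<in> \<P>" "t \<in> Q" "sep_inv t \<in> Q'"
      using sS t reduction_iff[OF f, unfolded red] by metis
    then show False
      using no1 no2 ors ort by metis
  qed
  then show "sep_le t s \<or> sep_le (sep_inv t) s"
    using s t feasible_task_inv[OF f t] unfolding sep_maximal_def sep_nested_iff by auto
qed

lemma extremal_nested_with: "extremal S s \<Longrightarrow> nested_with s S"
  by (auto simp: extremal_def nested_with_def sep_nested_iff)

text \<open>Up to inversion an element of \<open>S\<close> lies in \<open>P\<close> and so below
  some maximal \<open>m\<close> of \<open>P \<inter> S\<close>. Well-separatedness and consistency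
  leave only \<open>s = m\<close> or \<open>s \<le> sep_inv m\<close>, and both relations pass down
  from \<open>m\<close>.\<close>

lemma locally_maximal_nested_with:
  assumes f: "feasible_task G S \<P>" and s: "locally_maximal S \<P> s"
  shows "nested_with s S"
  unfolding nested_with_def
proof
  obtain P where P: "P \<in> \<P>" and ws: "well_separated S P" and max: "sep_maximal s (P \<inter> S)"
    using s unfolding locally_maximal_def by blast
  have in_P: "sep_nested s t" if t: "t \<in> P" "t \<in> S" for t
  proof -
    obtain m where m: "sep_maximal m (P \<inter> S)" "sep_le t m"
      using exists_sep_maximal[of "P \<inter> S" t] feasible_task_finite[OF f] t by auto
    have "sep_nested s m"
      using ws m(1) max unfolding well_separated_def nested_set_def by blast
    moreover have "\<not> sep_le (sep_inv m) s"
      using m(1) max feasible_task_consistent[OF f P]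
      unfolding sep_maximal_def consistent_iff by blast
    ultimately consider "s = m" | "sep_le s (sep_inv m)"
      using m(1) max unfolding sep_maximal_def sep_nested_iff by metis
    then show ?thesis
    proof cases
      case 1
      then show ?thesis using m(2) by (simp add: sep_nested_iff)
    next
      case 2
      then have "sep_le s (sep_inv t)"
        using m(2) by (metis sep_le_inv_inv sep_le_trans)
      then show ?thesis by (simp add: sep_nested_iff)
    qed
  qed
  fix t assume "t \<in> S"
  then show "sep_nested s t"
    using in_P feasible_task_orients[OF f P] feasible_task_inv[OF f] by (metis sep_nested_inv2)
qed

text \<open>\<open>red\<close> makes the reducing operations act on \<open>S\<close> itself.
  Nestedness with all of \<open>S\<close>, not just within the result, makes later recursive values
  compatible with the result.\<close>

lemma apply_op_subset:
  assumes f: "feasible_task G S \<P>" and red: "reduction S \<P> = S" and op: "op \<in> reducing_ops"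
    and s: "s \<in> apply_op op S \<P>"
  shows "s \<in> S" "nested_with s S" "sep_inv s \<in> apply_op op S \<P>"
proof -
  have S: "extremal S t \<Longrightarrow> t \<in> S" "locally_maximal S \<P> t \<Longrightarrow> t \<in> S" for t
    by (auto simp: extremal_def locally_maximal_def sep_maximal_def)
  have "nested_with t S \<and> sep_inv t \<in> ext S \<P> \<and> t \<in> S" if "t \<in> ext S \<P>" for t
  proof -
    consider "extremal S t" | u where "extremal S u" "t = sep_inv u"
      using \<open>t \<in> ext S \<P>\<close> unfolding ext_def by blast
    then show ?thesis
      by cases (use S(1) extremal_nested_with feasible_task_inv[OF f] in \<open>simp_all add: ext_def\<close>)
  qed
  note ext = this
  have "nested_with t S \<and> sep_inv t \<in> loc S \<P> \<and> t \<in> S" if "t \<in> loc S \<P>" for t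
  proof -
    consider "locally_maximal S \<P> t" | u where "locally_maximal S \<P> u" "t = sep_inv u"
      using \<open>t \<in> loc S \<P>\<close> unfolding loc_def by blast
    then show ?thesis
      by cases (use S(2) locally_maximal_nested_with[OF f] feasible_task_inv[OF f] in
          \<open>simp_all add: loc_def\<close>)
  qed
  note loc = this
  have all: "t \<in> S" "nested_with t S" "sep_inv t \<in> all_nested S \<P>" if "t \<in> all_nested S \<P>" for t
    using that feasible_task_inv[OF f] by (simp_all add: all_nested_def)
  show "s \<in> S" "nested_with s S" "sep_inv s \<in> apply_op op S \<P>"
    using op s ext loc all by (cases op; simp add: reducing_ops_def red)+
qed

text \<open>A single maximal \<open>m\<close> of \<open>S\<close> serves all three operations. Being
  extremal, it is the only maximal element of \<open>P \<inter> S\<close> for any profile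
  \<open>P\<close> containing it, so such a \<open>P\<close> is trivially well separated.\<close>

lemma apply_op_nonempty:
  assumes f: "feasible_task G S \<P>" and red: "reduction S \<P> = S" and op: "op \<in> reducing_ops"
    and ne: "S \<noteq> {}"
  shows "apply_op op S \<P> \<noteq> {}"
proof -
  obtain m where m: "sep_maximal m S"
    using ne exists_sep_maximal feasible_task_finite[OF f] by blast
  then have ext: "extremal S m" and mS: "m \<in> S"
    using maximal_extremal[OF f red] by (auto simp: sep_maximal_def)
  obtain P where P: "P \<in> \<P>" "m \<in> P"
    using mS reduction_iff[OF f, unfolded red] by blast
  have le: "sep_le t m" if "t \<in> P" "t \<in> S" for t
    using that ext P(2) feasible_task_consistent[OF f P(1)]
    unfolding extremal_def consistent_iff by blast
  then have "sep_maximal t (P \<inter> S) \<longleftrightarrow> t = m" for t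
    using m mS P(2) unfolding sep_maximal_def by blast
  then have "{t. sep_maximal t (P \<inter> S)} = {m}"
    by blast
  then have "locally_maximal S \<P> m"
    using P(1) unfolding locally_maximal_def well_separated_def nested_set_def
    by (metis mem_Collect_eq sep_nested_refl singleton_iff)
  then have "m \<in> ext S \<P> \<and> m \<in> loc S \<P> \<and> m \<in> all_nested S \<P>"
    using ext mS extremal_nested_with[OF ext] unfolding ext_def loc_def all_nested_def by blast
  then show ?thesis
    using op by (cases op) (auto simp: reducing_ops_def red)
qed

section \<open>Splitting along a nested separation system\<close>

text \<open>The set inducing a consistent orientation may be taken to be the orientation itself,
  since consistency supplies antisymmetry.\<close>

lemma consistent_orientations_iff:
  "Q \<in> consistent_orientations G N \<longleftrightarrow>
    Q \<subseteq> N \<and> consistent G Q \<and> (\<forall>n \<in> N. n \<in> Q \<or> sep_inv n \<in> Q)"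
proof
  assume "Q \<in> consistent_orientations G N"
  then show "Q \<subseteq> N \<and> consistent G Q \<and> (\<forall>n \<in> N. n \<in> Q \<or> sep_inv n \<in> Q)"
    unfolding consistent_orientations_def orientation_of_def orients_def by blast
next
  assume Q: "Q \<subseteq> N \<and> consistent G Q \<and> (\<forall>n \<in> N. n \<in> Q \<or> sep_inv n \<in> Q)"
  then have "orients Q N" "Q = Q \<inter> N" "\<forall>s \<in> Q. separation G s"
    using consistent_antisym unfolding orients_def antisymmetric_def consistent_iff by blast+
  then show "Q \<in> consistent_orientations G N"
    using Q unfolding consistent_orientations_def orientation_of_def by blast
qed

lemma splits_inv [simp]: "splits G (sep_inv s) Q \<longleftrightarrow> splits G s Q"
  by (auto simp: splits_def)

text \<open>Both extensions of \<open>Q\<close> are subsets of consistent sets. Hence passing to the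
  separations that split an orientation loses nothing that distinguishes two profiles inducing
  it.\<close>

lemma splits_between:
  assumes "consistent G P" "consistent G P'" "Q \<subseteq> P" "Q \<subseteq> P'" "s \<in> P" "sep_inv s \<in> P'"
  shows "splits G s Q"
  unfolding splits_def using assms consistent_subset by (metis insert_subset)

text \<open>Of the comparabilities between \<open>n\<close> and \<open>s\<close> or its inverse,
  consistency of the two extensions excludes those with \<open>sep_inv n\<close> on the lower
  side.\<close>

lemma splits_above:
  assumes "splits G s Q" "n \<in> Q" "sep_nested s n"
  shows "sep_le n s \<or> sep_le n (sep_inv s)"
proof -
  have "\<not> sep_le (sep_inv n) s" "\<not> sep_le (sep_inv n) (sep_inv s)"
    using assms(1,2) unfolding splits_def consistent_iff by blast+
  then show ?thesis
    using assms(3) by (auto simp: sep_nested_iff sep_le_inv_swap[of s])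
qed

text \<open>Two different orientations disagree on some \<open>n\<close>, with
  \<open>n \<in> Q\<close> and \<open>sep_inv n \<in> Q'\<close>. Then \<open>n\<close> lies below
  \<open>s\<close> and above \<open>t\<close>, each up to inversion, and transitivity compares
  them.\<close>

lemma splits_nested:
  assumes "Q \<in> consistent_orientations G N" "Q' \<in> consistent_orientations G N" "Q \<noteq> Q'"
    and s: "splits G s Q" "nested_with s N" and t: "splits G t Q'" "nested_with t N"
  shows "sep_nested s t"
proof -
  have N: "Q \<subseteq> N" "Q' \<subseteq> N" "\<And>n. n \<in> N \<Longrightarrow> n \<in> Q \<or> sep_inv n \<in> Q"
    "\<And>n. n \<in> N \<Longrightarrow> n \<in> Q' \<or> sep_inv n \<in> Q'"
    using assms(1,2) unfolding consistent_orientations_iff by blast+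
  consider m where "m \<in> Q" "m \<notin> Q'" | m where "m \<in> Q'" "m \<notin> Q"
    using assms(3) by blast
  then obtain n where n: "n \<in> N" "n \<in> Q" "sep_inv n \<in> Q'"
    using N by (metis sep_inv_inv subsetD)
  have "sep_le n s \<or> sep_le n (sep_inv s)"
    using splits_above[OF s(1) n(2)] s(2) n(1) by (simp add: nested_with_def)
  moreover have "sep_le (sep_inv n) t \<or> sep_le (sep_inv n) (sep_inv t)"
    using splits_above[OF t(1) n(3)] t(2) n(1) by (simp add: nested_with_def)
  then have "sep_le (sep_inv t) n \<or> sep_le t n"
    by (simp add: sep_inv_le_swap[of n])
  ultimately show ?thesis
    by (metis sep_le_trans sep_nested_iff sep_nested_sym sep_nested_inv1 sep_nested_inv2)
qed

text \<open>Serves both recursions, the one inside a strategy and the one over the orders.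
  Nestedness of members from different branches comes from \<open>splits_nested\<close>.\<close>

lemma nested_set_Un_splitting:
  assumes "nested_set N" "\<And>s. s \<in> S \<Longrightarrow> nested_with s N"
    and M: "\<And>Q. Q \<in> consistent_orientations G N \<Longrightarrow> M Q \<subseteq> seps_splitting G S Q"
      "\<And>Q. Q \<in> consistent_orientations G N \<Longrightarrow> nested_set (M Q)"
  shows "nested_set (N \<union> (\<Union>Q \<in> consistent_orientations G N. M Q))"
proof -
  have MS: "splits G s Q" "nested_with s N"
    if "Q \<in> consistent_orientations G N" "s \<in> M Q" for Q s
    using that M(1) assms(2) unfolding seps_splitting_def by blast+
  have MM: "sep_nested s t" if "Q \<in> consistent_orientations G N" "s \<in> M Q"
    "Q' \<in> consistent_orientations G N" "t \<in> M Q'" for Q Q' s t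
    using that M(2) MS splits_nested[of Q N Q' s t] unfolding nested_set_def by blast
  show ?thesis
    unfolding nested_set_def
  proof (intro ballI)
    fix s t
    assume "s \<in> N \<union> (\<Union>Q \<in> consistent_orientations G N. M Q)"
      "t \<in> N \<union> (\<Union>Q \<in> consistent_orientations G N. M Q)"
    then show "sep_nested s t"
      using assms(1) MM MS(2) sep_nested_sym unfolding nested_set_def nested_with_def by blast
  qed
qed

lemma seps_splitting_inv:
  assumes "\<And>s. s \<in> S \<Longrightarrow> sep_inv s \<in> S" "s \<in> seps_splitting G S Q"
  shows "sep_inv s \<in> seps_splitting G S Q"
  using assms by (simp add: seps_splitting_def)

lemma feasible_task_splitting:
  assumes "feasible_task G S \<P>"
  shows "feasible_task G (seps_splitting G S Q) (profiles_inducing \<P> N Q)"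
proof (rule feasible_task_restrict[OF assms])
  show "profiles_inducing \<P> N Q \<subseteq> \<P>" "seps_splitting G S Q \<subseteq> S"
    by (auto simp: profiles_inducing_def seps_splitting_def)
  show "sep_inv s \<in> seps_splitting G S Q" if "s \<in> seps_splitting G S Q" for s
    using that seps_splitting_inv feasible_task_inv[OF assms] by blast
  fix P P' s
  assume "P \<in> profiles_inducing \<P> N Q" "P' \<in> profiles_inducing \<P> N Q" "s \<in> S" "s \<in> P" "sep_inv s \<in> P'"
  then show "s \<in> seps_splitting G S Q"
    using splits_between[of P P' Q s] feasible_task_consistent[OF assms]
    unfolding profiles_inducing_def seps_splitting_def by blast
qed

text \<open>Puts each profile into one of the recursive calls, so that two profiles agreeing on
  \<open>N\<close> can be distinguished there.\<close>

lemma profile_orientation: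
  assumes "consistent G P" "separation_system G N" "\<And>n. n \<in> N \<Longrightarrow> n \<in> P \<or> sep_inv n \<in> P"
  shows "P \<inter> N \<in> consistent_orientations G N"
  unfolding consistent_orientations_iff
proof (intro conjI ballI)
  show "consistent G (P \<inter> N)"
    using assms(1) consistent_subset by blast
  show "n \<in> P \<inter> N \<or> sep_inv n \<in> P \<inter> N" if "n \<in> N" for n
    using that assms(2,3) unfolding separation_system_def by blast
qed auto

section \<open>Strategies\<close>

text \<open>Inclusion in the reduction rather than in \<open>S\<close> records that each separation
  found distinguishes two given profiles; essentiality is derived from this.\<close>

definition solution :: "'a sep set \<Rightarrow> 'a sep set set \<Rightarrow> 'a sep set \<Rightarrow> bool" where
  "solution S \<P> N \<longleftrightarrow> separation_system G N \<and> nested_set N \<and> N \<subseteq> reduction S \<P> \<and>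
    set_distinguishes N \<P>"

lemma separation_system_Un:
  "separation_system G N \<Longrightarrow> (\<And>Q. Q \<in> \<Q> \<Longrightarrow> separation_system G (M Q)) \<Longrightarrow>
    separation_system G (N \<union> (\<Union>Q \<in> \<Q>. M Q))"
  unfolding separation_system_def by blast

text \<open>Since all operations reduce, \<open>r_index\<close> is \<open>0\<close> at every stage
  and the size of \<open>S\<close> is a sufficient measure, even though \<open>\<sigma>\<close>
  changes to its shift.\<close>

lemma strategy_eval_exists:
  assumes "range \<sigma> \<subseteq> reducing_ops" "feasible_task G S \<P>"
  shows "\<exists>N. strategy_eval G \<sigma> S \<P> N \<and> solution S \<P> N"
  using assms
proof (induction "card S" arbitrary: S \<P> \<sigma> rule: less_induct)
  case less
  note f = less.prems(2)
  have \<sigma>0: "\<sigma> 0 \<in> reducing_ops"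
    using less.prems(1) by auto
  then have r0: "r_index \<sigma> = 0"
    unfolding r_index_def by (metis Least_eq_0)
  have dist: "set_distinguishes S \<P>"
    using f by (simp add: feasible_task_def task_def)
  have sub: "reduction S \<P> \<subseteq> S"
    by (auto simp: reduction_def)
  note fin = feasible_task_finite[OF f]
  consider (empty) "S = {}" | (reduce) "S \<noteq> {}" "reduction S \<P> \<subset> S"
    | (split) "S \<noteq> {}" "reduction S \<P> = S"
    using sub by blast
  then show ?case
  proof cases
    case empty
    then have "strategy_eval G \<sigma> S \<P> {}" "solution S \<P> {}"
      using f dist strategy_eval.empty[of G \<P> \<sigma>]
      by (auto simp: solution_def separation_system_def nested_set_def)
    then show ?thesis by blast
  next
    case reduce
    obtain N where N: "strategy_eval G \<sigma> (reduction S \<P>) \<P> N" "solution (reduction S \<P>) \<P> N"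
      using less.hyps[OF psubset_card_mono[OF fin reduce(2)] less.prems(1)
          feasible_task_reduction[OF f]] by blast
    have "strategy_eval G \<sigma> S \<P> N"
      using strategy_eval.reduce[OF f reduce(1) r0 reduce(2) N(1)] .
    moreover have "solution S \<P> N"
      using N(2) by (simp add: solution_def reduction_idem)
    ultimately show ?thesis by blast
  next
    case split
    define N where "N = apply_op (\<sigma> 0) S \<P>"
    note sub = apply_op_subset[OF f split(2) \<sigma>0, folded N_def]
    have sys: "separation_system G N"
      using sub feasible_task_separation[OF f] unfolding separation_system_def by blast
    have nested: "nested_set N"
      using sub unfolding nested_set_def nested_with_def by blast
    obtain n where n: "n \<in> N"
      using apply_op_nonempty[OF f split(2) \<sigma>0 split(1)] N_def by blast
    have ex: "\<exists>M. strategy_eval G (shift \<sigma>) (seps_splitting G S Q) (profiles_inducing \<P> N Q) M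
        \<and> solution (seps_splitting G S Q) (profiles_inducing \<P> N Q) M"
      if Q: "Q \<in> consistent_orientations G N" for Q
    proof -
      have "n \<in> Q \<or> sep_inv n \<in> Q"
        using Q n unfolding consistent_orientations_iff by blast
      \<comment> \<open>One of the two extensions would contain \<open>n\<close> together with its
        inverse. So \<open>n\<close> drops out of each \<open>seps_splitting G S Q\<close>, which is
        the strict decrease required for the recursive calls.\<close>
      then have "\<not> splits G n Q"
        using consistent_antisym[of "insert n Q" n] consistent_antisym[of "insert (sep_inv n) Q" "sep_inv n"]
        unfolding splits_def by auto
      then have "seps_splitting G S Q \<subset> S"
        using sub(1)[OF n] unfolding seps_splitting_def by blast
      moreover have "range (shift \<sigma>) \<subseteq> reducing_ops"
        using less.prems(1) by (auto simp: shift_def)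
      ultimately show ?thesis
        using less.hyps[OF psubset_card_mono[OF fin] _ feasible_task_splitting[OF f]] by blast
    qed
    obtain M where M: "strategy_eval G (shift \<sigma>) (seps_splitting G S Q) (profiles_inducing \<P> N Q) (M Q)"
      "solution (seps_splitting G S Q) (profiles_inducing \<P> N Q) (M Q)"
      if "Q \<in> consistent_orientations G N" for Q
      using ex by metis
    let ?N = "N \<union> (\<Union>Q \<in> consistent_orientations G N. M Q)"
    have "strategy_eval G \<sigma> S \<P> ?N"
      using strategy_eval.split[OF f split(1) _ N_def sys nested M(1)] split(2) by blast
    moreover have "solution S \<P> ?N"
      unfolding solution_def
    proof (intro conjI)
      show "separation_system G ?N"
        using separation_system_Un[OF sys, of _ M] M(2) unfolding solution_def by simp
      have MS: "M Q \<subseteq> seps_splitting G S Q" if "Q \<in> consistent_orientations G N" for Q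
        using M(2)[OF that] unfolding solution_def reduction_def by blast
      have SN: "nested_with s N" if "s \<in> S" for s
        using that sub(2) sep_nested_sym unfolding nested_with_def by blast
      have Mn: "nested_set (M Q)" if "Q \<in> consistent_orientations G N" for Q
        using M(2)[OF that] unfolding solution_def by blast
      show "nested_set ?N"
        by (rule nested_set_Un_splitting[OF nested SN MS Mn])
      have "M Q \<subseteq> S" if "Q \<in> consistent_orientations G N" for Q
        using MS[OF that] unfolding seps_splitting_def by blast
      \<comment> \<open>In this case \<open>S\<close> equals its reduction, so inclusion in
        \<open>S\<close> is all there is to show.\<close>
      then show "?N \<subseteq> reduction S \<P>"
        using sub(1) split(2) by blast
      show "set_distinguishes ?N \<P>"
        unfolding set_distinguishes_def
      proof (intro ballI impI)
        fix P P' assume P: "P \<in> \<P>" "P' \<in> \<P>" "P \<noteq> P'"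
        have or: "n \<in> R \<or> sep_inv n \<in> R" if "R \<in> \<P>" "n \<in> N" for R n
          using feasible_task_orients[OF f that(1)] sub(1) that(2) by blast
        show "\<exists>s \<in> ?N. distinguishes s P P'"
        proof (cases "P \<inter> N = P' \<inter> N")
          case True
          have Q: "P \<inter> N \<in> consistent_orientations G N"
            using profile_orientation feasible_task_consistent[OF f P(1)] sys or P(1) by blast
          have "P \<in> profiles_inducing \<P> N (P \<inter> N)" "P' \<in> profiles_inducing \<P> N (P \<inter> N)"
            using P True by (auto simp: profiles_inducing_def)
          then obtain s where "s \<in> M (P \<inter> N)" "distinguishes s P P'"
            using M(2)[OF Q] P(3) unfolding solution_def set_distinguishes_def by meson
          then show ?thesis
            using Q by blast
        next
          case False
          then obtain n where "n \<in> N" "n \<in> P \<and> n \<notin> P' \<or> n \<in> P' \<and> n \<notin> P" by blast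
          moreover have "n \<in> P \<or> sep_inv n \<in> P" "n \<in> P' \<or> sep_inv n \<in> P'"
            using or P(1,2) \<open>n \<in> N\<close> by blast+
          ultimately have "distinguishes n P P'"
            using distinguishes_iff[of P P' n] feasible_task_consistent[OF f] P(1,2) by blast
          then show ?thesis
            using \<open>n \<in> N\<close> by blast
        qed
      qed
    qed
    ultimately show ?thesis by blast
  qed
qed

end

section \<open>Nested separations of a fixed order\<close>

context pair_graph
begin

lemma efficiently_distinguishes_minimal:
  assumes "efficiently_distinguishes G s P P'" "separation G u" "distinguishes u P P'"
  shows "sep_order s \<le> sep_order u"
  using assms unfolding efficiently_distinguishes_def kappa_def by (metis (mono_tags, lifting) Least_le)

lemma efficiently_distinguishesI:
  assumes "separation G s" "distinguishes s P P'"
    and "\<And>u. separation G u \<Longrightarrow> distinguishes u P P' \<Longrightarrow> sep_order s \<le> sep_order u"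
  shows "efficiently_distinguishes G s P P'"
proof -
  have "kappa G P P' = sep_order s"
    unfolding kappa_def by (rule Least_equality) (use assms in blast)+
  then show ?thesis
    using assms(1,2) by (simp add: efficiently_distinguishes_def)
qed

lemma distinguishes_sym: "distinguishes s P P' \<longleftrightarrow> distinguishes s P' P"
  by (auto simp: distinguishes_def)

lemma distinguishes_truncate:
  "distinguishes s (truncate_profile l P) (truncate_profile l P') \<longleftrightarrow>
    sep_order s < l \<and> distinguishes s P P'"
  by (auto simp: distinguishes_def truncate_profile_def)

lemma truncate_profile_eqD:
  assumes "truncate_profile l P = truncate_profile l P'" "sep_order s < l"
  shows "s \<in> P \<longleftrightarrow> s \<in> P'"
  using assms unfolding truncate_profile_def by blast

lemma k_profile_eqI:
  assumes P: "k_profile G k P" "k_profile G k P'" and no: "\<And>s. \<not> distinguishes s P P'"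
  shows "P = P'"
proof -
  have sub: "Q \<subseteq> Q'"
    if Q: "k_profile G k Q" "k_profile G k Q'" "\<And>s. \<not> distinguishes s Q Q'" for Q Q'
  proof
    fix s assume s: "s \<in> Q"
    then have "separation G s" "sep_order s < k"
      using Q(1) k_profile_consistent consistent_iff unfolding k_profile_def by blast+
    then show "s \<in> Q'"
      using k_profile_cases[OF Q(2)] s Q(3)[of s] distinguishes_iff k_profile_consistent Q(1,2)
      by metis
  qed
  show ?thesis
    using sub[OF P no] sub[OF P(2,1)] no distinguishes_sym by blast
qed

text \<open>Provides the decreasing measure. What \<open>N\<close> contains that is nested with
  \<open>s\<close> is also nested with \<open>n\<close>, hence with the corner; and
  \<open>n\<close>, which crosses \<open>s\<close>, lies below the corner.\<close>

lemma cross_sup_psubset: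
  assumes "nested_set N" "n \<in> N" "sep_cross s n"
  shows "{m \<in> N. sep_cross (sep_sup s n) m} \<subset> {m \<in> N. sep_cross s m}"
proof -
  have "sep_nested (sep_sup s n) m" if "m \<in> N" "sep_nested s m" for m
  proof -
    have "sep_nested m n" "sep_nested m s"
      using that assms(1,2) sep_nested_sym unfolding nested_set_def by blast+
    then show ?thesis
      using cross_nested_sup[OF assms(3)] sep_nested_sym by blast
  qed
  moreover have "sep_nested (sep_sup s n) n"
    using sep_le_sup2[of n s] by (simp add: sep_nested_iff)
  ultimately show ?thesis
    using assms(2,3) by blast
qed

text \<open>Turns essentiality into a usable form: the pair is ordered so that \<open>R\<close>
  contains \<open>n\<close>, and efficiency becomes agreement below the order of \<open>n\<close>.
  \<open>R\<close> and \<open>R'\<close> are full profiles; truncation is harmless because those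
  orders are less than \<open>l\<close>.\<close>

lemma essential_truncateE:
  assumes k: "\<And>P. P \<in> \<P> \<Longrightarrow> k_profile G (Suc l) P"
    and "essential G (truncate_profile l ` \<P>) n"
  obtains R R' where "R \<in> \<P>" "R' \<in> \<P>" "n \<in> R" "sep_inv n \<in> R'" "separation G n" "sep_order n < l"
    "\<And>u. u \<in> R \<Longrightarrow> sep_order u < sep_order n \<Longrightarrow> u \<in> R'"
proof -
  obtain R0 R0' where R0: "R0 \<in> \<P>" "R0' \<in> \<P>"
    and eff: "efficiently_distinguishes G n (truncate_profile l R0) (truncate_profile l R0')"
    using assms(2) unfolding essential_def by blast
  have n: "separation G n" "sep_order n < l" "distinguishes n R0 R0'"
    using eff by (simp_all add: efficiently_distinguishes_def distinguishes_truncate)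
  have minimal: "\<not> distinguishes u R0 R0'" if "separation G u" "sep_order u < sep_order n" for u
    using efficiently_distinguishes_minimal[OF eff that(1)] that(2) n(2)
    by (auto simp: distinguishes_truncate)
  have "\<exists>R \<in> \<P>. \<exists>R' \<in> \<P>. n \<in> R \<and> sep_inv n \<in> R' \<and>
      (\<forall>u. separation G u \<and> sep_order u < sep_order n \<longrightarrow> \<not> distinguishes u R R')"
    using n(3) R0 minimal distinguishes_sym[of _ R0 R0'] unfolding distinguishes_def[of n] by blast
  then obtain R R' where R: "R \<in> \<P>" "R' \<in> \<P>" "n \<in> R" "sep_inv n \<in> R'"
    and min: "\<And>u. separation G u \<Longrightarrow> sep_order u < sep_order n \<Longrightarrow> \<not> distinguishes u R R'"
    by blast
  note c = k_profile_consistent[OF k[OF R(1)]] k_profile_consistent[OF k[OF R(2)]]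
  have "u \<in> R'" if u: "u \<in> R" "sep_order u < sep_order n" for u
  proof -
    have "separation G u"
      using c(1) u(1) by (simp add: consistent_iff)
    moreover from this have "sep_inv u \<notin> R'"
      using min[of u] u distinguishes_iff[OF c, of u] by blast
    moreover have "sep_order u < Suc l"
      using u(2) n(2) by simp
    ultimately show ?thesis
      using k_profile_cases[OF k[OF R(2)], of u] by blast
  qed
  then show thesis
    using that[OF R n(1,2)] by blast
qed

text \<open>If both corners of \<open>s\<close> with \<open>n\<close> had order greater than \<open>l\<close>, the opposite corners would by
  submodularity have order less than that of \<open>n\<close>. Two profiles efficiently distinguished by \<open>n\<close> then
  agree on those corners, and the one containing \<open>sep_inv n\<close> violates the profile property
  whichever way it orients \<open>s\<close>.\<close>

lemma corner_order:
  assumes k: "\<And>P. P \<in> \<P> \<Longrightarrow> k_profile G (Suc l) P"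
    and n: "essential G (truncate_profile l ` \<P>) n"
    and s: "separation G s" "sep_order s = l"
  shows "sep_order (sep_sup s n) \<le> l \<or> sep_order (sep_sup (sep_inv s) n) \<le> l"
proof (rule ccontr)
  assume neg: "\<not> ?thesis"
  obtain R R' where R: "R \<in> \<P>" "R' \<in> \<P>" "n \<in> R" "sep_inv n \<in> R'"
    and ns: "separation G n" "sep_order n < l"
    and agree: "\<And>u. u \<in> R \<Longrightarrow> sep_order u < sep_order n \<Longrightarrow> u \<in> R'"
    using essential_truncateE[OF k n] by blast
  let ?a = "sep_sup (sep_inv s) (sep_inv n)"
  let ?b = "sep_sup s (sep_inv n)"
  have ord: "sep_order ?a < sep_order n" "sep_order ?b < sep_order n"
    using neg sep_order_sup_add[of s n] sep_order_sup_add[of "sep_inv s" n] s ns by auto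
  have sep: "separation G ?a" "separation G ?b"
    using s(1) ns(1) by (simp_all add: separation_sup)
  have le: "sep_le (sep_inv ?a) n" "sep_le (sep_inv ?b) n"
    using sep_le_sup2 by (metis sep_le_inv_inv sep_inv_inv)+
  \<comment> \<open>The inverses of both small corners lie below \<open>n\<close>, which belongs to
    \<open>R\<close>; their orders are less than that of \<open>n\<close>, so \<open>R'\<close>
    contains them as well.\<close>
  have "sep_inv ?a \<in> R" "sep_inv ?b \<in> R"
    using k_profile_le[OF k[OF R(1)] R(3) _ le(1)] k_profile_le[OF k[OF R(1)] R(3) _ le(2)]
      sep ord ns(2) by simp_all
  then have inR': "sep_inv ?a \<in> R'" "sep_inv ?b \<in> R'"
    using agree ord by simp_all
  note k' = k[OF R(2)]
  have "s \<in> R' \<or> sep_inv s \<in> R'"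
    using k_profile_cases[OF k' s(1)] s(2) by blast
  then have "?b \<in> R' \<or> ?a \<in> R'"
    using k_profile_sup[OF k' _ R(4), of s] k_profile_sup[OF k' _ R(4), of "sep_inv s"] ord ns(2)
    by auto
  then show False
    using inR' consistent_antisym[OF k_profile_consistent[OF k']] by blast
qed

text \<open>The corner lies above \<open>s\<close>, so \<open>P'\<close> cannot contain it; having
  order at most \<open>l\<close> it is oriented by \<open>P'\<close>, and a smaller order would
  contradict the agreement below \<open>l\<close>. Nothing is assumed about how \<open>P'\<close>
  orients \<open>t\<close>, so \<open>t\<close> may come from \<open>N\<close> or be another
  distinguishing separation.\<close>

lemma distinguishing_corner:
  assumes k: "k_profile G (Suc l) P" "k_profile G (Suc l) P'"
    and eq: "truncate_profile l P = truncate_profile l P'"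
    and s: "s \<in> P" "sep_inv s \<in> P'" and t: "t \<in> P" and ord: "sep_order (sep_sup s t) \<le> l"
  shows "sep_sup s t \<in> P" "sep_inv (sep_sup s t) \<in> P'" "sep_order (sep_sup s t) = l"
proof -
  show P: "sep_sup s t \<in> P"
    using k_profile_sup[OF k(1) s(1) t] ord by simp
  then have sep: "separation G (sep_sup s t)"
    using k_profile_consistent[OF k(1)] by (simp add: consistent_iff)
  have "sep_sup s t \<notin> P'"
    using consistent_le[OF k_profile_consistent[OF k(2)] _ sep_le_sup1] s(2) by blast
  then show "sep_inv (sep_sup s t) \<in> P'"
    using k_profile_cases[OF k(2) sep le_imp_less_Suc[OF ord]] by blast
  show "sep_order (sep_sup s t) = l"
    using truncate_profile_eqD[OF eq] P \<open>sep_sup s t \<notin> P'\<close> ord by (meson le_neq_implies_less)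
qed

lemma distinguishing_nested:
  assumes k: "\<And>P. P \<in> \<P> \<Longrightarrow> k_profile G (Suc l) P"
    and N: "nested_set N" "\<And>n. n \<in> N \<Longrightarrow> essential G (truncate_profile l ` \<P>) n"
      "\<And>n. n \<in> N \<Longrightarrow> sep_inv n \<in> N"
    and P: "P \<in> \<P>" "P' \<in> \<P>" "P \<noteq> P'" "truncate_profile l P = truncate_profile l P'"
  obtains s where "s \<in> P" "sep_inv s \<in> P'" "separation G s" "sep_order s = l" "nested_with s N"
proof -
  note kP = k[OF P(1)] k[OF P(2)]
  note cP = k_profile_consistent[OF kP(1)] k_profile_consistent[OF kP(2)]
  have N_sep: "separation G n \<and> sep_order n < l" if "n \<in> N" for n
    using essential_truncateE[OF k N(2)[OF that]] by blast
  then have "finite N"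
    using finite_separations by (meson finite_subset mem_Collect_eq subsetI)
  have step: "\<exists>s. s \<in> P \<and> sep_inv s \<in> P' \<and> sep_order s = l \<and> nested_with s N"
    if "s \<in> P" "sep_inv s \<in> P'" "sep_order s = l" for s
    using that
  proof (induction "card {m \<in> N. sep_cross s m}" arbitrary: s rule: less_induct)
    case less
    show ?case
    proof (cases "nested_with s N")
      case True
      then show ?thesis using less.prems by blast
    next
      case False
      then obtain n0 where n0: "n0 \<in> N" "sep_cross s n0"
        by (auto simp: nested_with_def)
      then have "n0 \<in> P \<or> sep_inv n0 \<in> P"
        using k_profile_cases[OF kP(1)] N_sep[OF n0(1)] by (meson less_SucI)
      then obtain n where n: "n \<in> N" "sep_cross s n" "n \<in> P"
        using n0 N(3) by (metis sep_nested_inv2)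
      \<comment> \<open>Agreement below order \<open>l\<close> puts \<open>n\<close> into both
        profiles, so a corner can be formed from the side of either.\<close>
      then have nP': "n \<in> P'"
        using truncate_profile_eqD[OF P(4)] N_sep by blast
      have sep: "separation G s"
        using less.prems(1) cP(1) by (simp add: consistent_iff)
      have card: "card {m \<in> N. sep_cross (sep_sup t n) m} < card {m \<in> N. sep_cross s m}"
        if "t = s \<or> t = sep_inv s" for t
        using cross_sup_psubset[OF N(1) n(1), of t] n(2) that \<open>finite N\<close>
        by (auto intro!: psubset_card_mono)
      consider "sep_order (sep_sup s n) \<le> l" | "sep_order (sep_sup (sep_inv s) n) \<le> l"
        using corner_order[OF k N(2)[OF n(1)] sep less.prems(3)] by blast
      then show ?thesis
      proof cases
        case 1
        show ?thesis
          using less.hyps[OF card] distinguishing_corner[OF kP P(4) less.prems(1,2) n(3) 1] by blast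
      next
        case 2
        \<comment> \<open>The roles of \<open>P\<close> and \<open>P'\<close> are exchanged here:
          the small corner belongs to \<open>P'\<close>, and its inverse is the new candidate in
          \<open>P\<close>.\<close>
        let ?t = "sep_inv (sep_sup (sep_inv s) n)"
        have "?t \<in> P" "sep_inv ?t \<in> P'" "sep_order ?t = l"
          using distinguishing_corner[OF kP(2,1) P(4)[symmetric] less.prems(2) _ nP' 2] less.prems(1)
          by simp_all
        then show ?thesis
          using less.hyps[of ?t] card[of "sep_inv s"] by simp
      qed
    qed
  qed
  obtain s0 where s0: "distinguishes s0 P P'"
    using k_profile_eqI[OF kP] P(3) by blast
  then obtain s where s: "s \<in> P" "sep_inv s \<in> P'"
    unfolding distinguishes_def by (metis DiffD1 sep_inv_inv)
  then have "s \<notin> P'"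
    using consistent_antisym[OF cP(2)] by blast
  then have "\<not> sep_order s < l"
    using truncate_profile_eqD[OF P(4)] s by blast
  moreover have "sep_order s < Suc l"
    using kP(1) s(1) by (simp add: k_profile_def)
  ultimately have "sep_order s = l"
    by simp
  then show thesis
    using step[OF s] that cP(1) unfolding consistent_iff by blast
qed

text \<open>\<open>Q\<close> and \<open>\<P>'\<close> are kept abstract so that the start, where
  \<open>l = 0\<close> and \<open>N\<close> and \<open>Q\<close> are empty, is an instance in the
  same way as the larger orders.\<close>

lemma feasible_task_level:
  assumes k: "\<And>P. P \<in> \<P> \<Longrightarrow> k_profile G (Suc l) P"
    and N: "nested_set N" "\<And>n. n \<in> N \<Longrightarrow> essential G (truncate_profile l ` \<P>) n"
      "\<And>n. n \<in> N \<Longrightarrow> sep_inv n \<in> N"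
    and \<P>': "\<P>' \<subseteq> \<P>" "\<And>P. P \<in> \<P>' \<Longrightarrow> Q \<subseteq> P"
      "\<And>P P'. P \<in> \<P>' \<Longrightarrow> P' \<in> \<P>' \<Longrightarrow> truncate_profile l P = truncate_profile l P'"
    and S: "S = {s. separation G s \<and> proper_sep s \<and> sep_order s = l \<and> nested_with s N}"
  shows "feasible_task G (seps_splitting G S Q) \<P>'"
proof (rule feasible_taskI)
  have k': "k_profile G (Suc l) P" if "P \<in> \<P>'" for P
    using that k \<P>'(1) by blast
  have keep: "s \<in> seps_splitting G S Q"
    if "P \<in> \<P>'" "P' \<in> \<P>'" "s \<in> P" "sep_inv s \<in> P'" "sep_order s = l" "nested_with s N" for P P' s
  proof -
    note c = k_profile_consistent[OF k'[OF that(1)]] k_profile_consistent[OF k'[OF that(2)]]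
    have "splits G s Q"
      using splits_between[OF c \<P>'(2)[OF that(1)] \<P>'(2)[OF that(2)] that(3,4)] .
    moreover have "proper_sep s"
      using consistent_proper[OF c(1) that(3) c(2) that(4)] .
    moreover have "separation G s"
      using c(1) that(3) by (simp add: consistent_iff)
    ultimately show ?thesis
      using that(5,6) by (simp add: S seps_splitting_def)
  qed
  show "separation G s" "proper_sep s" if "s \<in> seps_splitting G S Q" for s
    using that by (auto simp: S seps_splitting_def)
  show "sep_inv s \<in> seps_splitting G S Q" if "s \<in> seps_splitting G S Q" for s
    using that by (auto simp: S seps_splitting_def)
  show "profile G P" if "P \<in> \<P>'" for P
    using k'[OF that] by (simp add: k_profile_def)
  show "s \<in> P \<or> sep_inv s \<in> P" if "P \<in> \<P>'" "s \<in> seps_splitting G S Q" for P s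
    using k_profile_cases[OF k'[OF that(1)], of s] that(2) by (auto simp: S seps_splitting_def)
  show "\<exists>s \<in> seps_splitting G S Q. distinguishes s P P'"
    if P: "P \<in> \<P>'" "P' \<in> \<P>'" "P \<noteq> P'" for P P'
  proof -
    have "P \<in> \<P>" "P' \<in> \<P>"
      using P \<P>'(1) by blast+
    then obtain s where s: "s \<in> P" "sep_inv s \<in> P'" "sep_order s = l" "nested_with s N"
      using distinguishing_nested[OF k N _ _ P(3) \<P>'(3)[OF P(1,2)]] by blast
    then have "distinguishes s P P'"
      using distinguishes_iff k_profile_consistent k' P by blast
    then show ?thesis
      using keep[OF P(1,2) s] by blast
  qed
  show "\<exists>u \<in> P \<inter> seps_splitting G S Q. sep_le (sep_sup s t) u"
    if P: "P \<in> \<P>'" "P' \<in> \<P>'" and st: "s \<in> seps_splitting G S Q" "t \<in> seps_splitting G S Q"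
      and cross: "sep_cross s t" and o: "s \<in> P" "t \<in> P" "sep_inv s \<in> P'" "sep_inv t \<in> P'"
    for P P' s t
  proof -
    note kP = k'[OF P(1)] k'[OF P(2)] and eq = \<P>'(3)[OF P]
    have s: "separation G s" "sep_order s = l" "nested_with s N"
      and t: "separation G t" "sep_order t = l" "nested_with t N"
      using st by (auto simp: S seps_splitting_def)
    \<comment> \<open>Each implication says that the corner has order at least \<open>l\<close>. The
      two orders add up to \<open>2 * l\<close>, so both equal \<open>l\<close>, and the join itself
      is the bound that feasibility asks for.\<close>
    have corner: "sep_order (sep_sup s t) \<le> l \<Longrightarrow> sep_order (sep_sup s t) = l"
      "sep_order (sep_sup (sep_inv s) (sep_inv t)) \<le> l \<Longrightarrow>
        sep_order (sep_sup (sep_inv s) (sep_inv t)) = l"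
      using distinguishing_corner(3)[OF kP eq o(1,3,2)]
        distinguishing_corner(3)[OF kP(2,1) eq[symmetric] o(3) _ o(4)] o(1) by simp_all
    have ord: "sep_order (sep_sup s t) = l"
      using corner sep_order_sup_add[OF s(1) t(1)] s(2) t(2) by linarith
    then have "sep_sup s t \<in> P" "sep_inv (sep_sup s t) \<in> P'"
      using distinguishing_corner(1,2)[OF kP eq o(1,3,2)] by simp_all
    then have "sep_sup s t \<in> seps_splitting G S Q"
      using keep[OF P] ord cross_nested_with_sup[OF cross s(3) t(3)] by blast
    then show ?thesis
      using \<open>sep_sup s t \<in> P\<close> sep_le_refl[of "sep_sup s t"] by blast
  qed
qed

end

section \<open>Existence\<close>

definition k_solution ::
    "'a pair_pre_digraph \<Rightarrow> 'a sep set set \<Rightarrow> 'a sep set \<Rightarrow> bool" where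
  "k_solution G \<P> N \<longleftrightarrow> separation_system G N \<and> nested_set N \<and> (\<forall>s \<in> N. essential G \<P> s) \<and>
    (\<forall>P \<in> \<P>. \<forall>P' \<in> \<P>. P \<noteq> P' \<longrightarrow> (\<exists>s \<in> N. efficiently_distinguishes G s P P'))"

context pair_graph
begin

text \<open>A competitor of smaller order would have order less than \<open>l\<close> and so would
  already distinguish the truncations.\<close>

lemma efficiently_distinguishes_truncate:
  assumes "efficiently_distinguishes G s (truncate_profile l P) (truncate_profile l P')"
  shows "efficiently_distinguishes G s P P'"
proof (rule efficiently_distinguishesI)
  have s: "sep_order s < l" "distinguishes s P P'"
    using assms by (simp_all add: efficiently_distinguishes_def distinguishes_truncate)
  show "distinguishes s P P'" "separation G s"
    using assms s by (simp_all add: efficiently_distinguishes_def)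
  show "sep_order s \<le> sep_order u" if "separation G u" "distinguishes u P P'" for u
    using efficiently_distinguishes_minimal[OF assms that(1)] that(2) s(1)
    by (force simp: distinguishes_truncate)
qed

text \<open>Profiles with equal truncations are distinguished by nothing of order less than
  \<open>l\<close>, so order \<open>l\<close> is the least possible.\<close>

lemma efficiently_distinguishes_level:
  assumes "truncate_profile l P = truncate_profile l P'"
    and "distinguishes s P P'" "separation G s" "sep_order s = l"
  shows "efficiently_distinguishes G s P P'"
proof (rule efficiently_distinguishesI)
  show "sep_order s \<le> sep_order u" if "separation G u" "distinguishes u P P'" for u
    using truncate_profile_eqD[OF assms(1), of u] that(2) assms(4)
    unfolding distinguishes_def by (metis DiffD1 DiffD2 not_le_imp_less)
qed (use assms in blast)+

lemma k_strategy_eval_exists: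
  assumes "\<Sigma> \<noteq> []" "\<forall>\<sigma> \<in> set \<Sigma>. range \<sigma> \<subseteq> reducing_ops"
    and "\<forall>P \<in> \<P>. k_profile G (length \<Sigma>) P"
  shows "\<exists>N. k_strategy_eval G \<Sigma> \<P> N \<and> k_solution G \<P> N"
  using assms
proof (induction \<Sigma> arbitrary: \<P> rule: rev_induct)
  case Nil
  then show ?case by simp
next
  case (snoc \<sigma> \<Sigma>)
  define l where "l = length \<Sigma>"
  have \<sigma>: "range \<sigma> \<subseteq> reducing_ops"
    using snoc.prems(2) by simp
  have k: "k_profile G (Suc l) P" if "P \<in> \<P>" for P
    using snoc.prems(3) that by (simp add: l_def)
  show ?case
  proof (cases "\<Sigma> = []")
    case True
    define S where "S = {s. separation G s \<and> proper_sep s \<and> sep_order s < 1}"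
    have l0: "l = 0"
      using True by (simp add: l_def)
    have tr: "truncate_profile l P = {}" for P :: "'a sep set"
      by (simp add: l0 truncate_profile_def)
    \<comment> \<open>Properness of \<open>s\<close> is consistency of each of the two singletons.
      Thus the proper separations of order \<open>0\<close> form a level over the empty set, with
      the empty orientation.\<close>
    have "splits G s {}" if "separation G s" "proper_sep s" for s
      using that by (auto simp: splits_def consistent_iff proper_sep_iff)
    then have "seps_splitting G S {} = S"
      by (auto simp: S_def seps_splitting_def)
    moreover have "feasible_task G (seps_splitting G S {}) \<P>"
    proof (rule feasible_task_level[OF k, where N = "{}"])
      show "S = {s. separation G s \<and> proper_sep s \<and> sep_order s = l \<and> nested_with s {}}"
        by (auto simp: S_def l0 nested_with_def)
      show "\<P> \<subseteq> \<P>" ..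
    qed (simp_all add: tr nested_set_def)
    ultimately obtain N where N: "strategy_eval G \<sigma> S \<P> N" "solution S \<P> N"
      using strategy_eval_exists[OF \<sigma>] by metis
    have eff: "efficiently_distinguishes G s P P'" if "distinguishes s P P'" "s \<in> N" for s P P'
    proof -
      have "separation G s" "sep_order s = l"
        using that(2) N(2) by (auto simp: solution_def reduction_def S_def l0)
      then show ?thesis
        using efficiently_distinguishes_level that(1) tr by metis
    qed
    have "\<forall>s \<in> N. essential G \<P> s"
      using eff N(2) unfolding solution_def reduction_def essential_def by blast
    moreover have "\<forall>P \<in> \<P>. \<forall>P' \<in> \<P>. P \<noteq> P' \<longrightarrow> (\<exists>s \<in> N. efficiently_distinguishes G s P P')"
      using eff N(2) unfolding solution_def set_distinguishes_def by meson
    ultimately have "k_solution G \<P> N"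
      using N(2) by (simp add: solution_def k_solution_def)
    moreover have "k_strategy_eval G (\<Sigma> @ [\<sigma>]) \<P> N"
      using k_strategy_eval.single N(1) True by (simp add: S_def)
    ultimately show ?thesis by blast
  next
    case False
    have tr: "\<forall>P \<in> truncate_profile l ` \<P>. k_profile G (length \<Sigma>) P"
      using k_profile_truncate[OF k, of _ l] by (auto simp: l_def)
    obtain N where ev: "k_strategy_eval G \<Sigma> (truncate_profile l ` \<P>) N"
      and sol: "k_solution G (truncate_profile l ` \<P>) N"
      using snoc.IH[OF False _ tr] snoc.prems(2) by force
    have sys: "separation_system G N" and nested: "nested_set N"
      and ess: "\<And>n. n \<in> N \<Longrightarrow> essential G (truncate_profile l ` \<P>) n"
      using sol by (simp_all add: k_solution_def)
    have inv: "sep_inv n \<in> N" if "n \<in> N" for n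
      using sys that by (simp add: separation_system_def)
    have N_ord: "separation G n" "sep_order n < l" if "n \<in> N" for n
      using essential_truncateE[OF k ess[OF that]] by blast+
    \<comment> \<open>\<open>N\<close> distinguishes any two different truncations, so inducing the
      same orientation of \<open>N\<close> means agreeing on all separations of order less than
      \<open>l\<close>.\<close>
    have same: "truncate_profile l P = truncate_profile l P'"
      if P: "P \<in> \<P>" "P' \<in> \<P>" "P \<inter> N = P' \<inter> N" for P P'
    proof (rule ccontr)
      assume "truncate_profile l P \<noteq> truncate_profile l P'"
      then obtain n where "n \<in> N" "distinguishes n P P'"
        using sol P(1,2) unfolding k_solution_def efficiently_distinguishes_def
        by (metis distinguishes_truncate imageI)
      then show False
        using P(3) unfolding distinguishes_def by blast
    qed
    define S where "S = {s. separation G s \<and> proper_sep s \<and> sep_order s = l \<and> nested_with s N}"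
    have feas: "feasible_task G (seps_splitting G S Q) (profiles_inducing \<P> N Q)" for Q
    proof (rule feasible_task_level[OF k nested ess inv _ _ _ S_def])
      show "profiles_inducing \<P> N Q \<subseteq> \<P>"
        by (auto simp: profiles_inducing_def)
      show "Q \<subseteq> P" if "P \<in> profiles_inducing \<P> N Q" for P
        using that by (auto simp: profiles_inducing_def)
      show "truncate_profile l P = truncate_profile l P'"
        if "P \<in> profiles_inducing \<P> N Q" "P' \<in> profiles_inducing \<P> N Q" for P P'
        using that same by (simp add: profiles_inducing_def)
    qed
    obtain M where M: "strategy_eval G \<sigma> (seps_splitting G S Q) (profiles_inducing \<P> N Q) (M Q)"
      "solution (seps_splitting G S Q) (profiles_inducing \<P> N Q) (M Q)" for Q
      using strategy_eval_exists[OF \<sigma> feas] by metis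
    let ?N = "N \<union> (\<Union>Q \<in> consistent_orientations G N. M Q)"
    have "k_strategy_eval G (\<Sigma> @ [\<sigma>]) \<P> ?N"
      using k_strategy_eval.snoc[OF False ev[unfolded l_def] sys nested S_def[unfolded l_def] M(1)] .
    moreover have "k_solution G \<P> ?N"
      unfolding k_solution_def
    proof (intro conjI)
      have MS: "M Q \<subseteq> seps_splitting G S Q" for Q
        using M(2)[of Q] unfolding solution_def reduction_def by blast
      have Mn: "nested_set (M Q)" and Msys: "separation_system G (M Q)" for Q
        using M(2)[of Q] unfolding solution_def by blast+
      have SN: "nested_with s N" if "s \<in> S" for s
        using that by (simp add: S_def)
      show "separation_system G ?N"
        by (rule separation_system_Un[OF sys Msys])
      show "nested_set ?N"
        by (rule nested_set_Un_splitting[OF nested SN MS Mn])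
      have eff: "efficiently_distinguishes G s P P'"
        if "s \<in> M Q" "distinguishes s P P'" "P \<in> profiles_inducing \<P> N Q"
          "P' \<in> profiles_inducing \<P> N Q" for s Q P P'
      proof (rule efficiently_distinguishes_level[OF _ that(2)])
        show "truncate_profile l P = truncate_profile l P'"
          using that(3,4) same by (simp add: profiles_inducing_def)
        show "separation G s" "sep_order s = l"
          using MS that(1) by (auto simp: S_def seps_splitting_def)
      qed
      have "essential G \<P> s" if "s \<in> N" for s
        using ess[OF that] efficiently_distinguishes_truncate unfolding essential_def by blast
      moreover have "essential G \<P> s" if s: "s \<in> M Q" for s Q
      proof -
        obtain P P' where P: "P \<in> profiles_inducing \<P> N Q" "P' \<in> profiles_inducing \<P> N Q"
          "distinguishes s P P'"
          using M(2)[of Q] s unfolding solution_def reduction_def by blast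
        then show ?thesis
          using eff[OF s P(3,1,2)] unfolding essential_def profiles_inducing_def by blast
      qed
      ultimately show "\<forall>s \<in> ?N. essential G \<P> s" by blast
      show "\<forall>P \<in> \<P>. \<forall>P' \<in> \<P>. P \<noteq> P' \<longrightarrow> (\<exists>s \<in> ?N. efficiently_distinguishes G s P P')"
      proof (intro ballI impI)
        fix P P' assume P: "P \<in> \<P>" "P' \<in> \<P>" "P \<noteq> P'"
        show "\<exists>s \<in> ?N. efficiently_distinguishes G s P P'"
        proof (cases "truncate_profile l P = truncate_profile l P'")
          case True
          \<comment> \<open>The elements of \<open>N\<close> have order less than \<open>l\<close>,
            so the two profiles end up in the same recursive call.\<close>
          have "P \<inter> N = P' \<inter> N"
            using truncate_profile_eqD[OF True] N_ord(2) by blast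
          then have ind: "P \<in> profiles_inducing \<P> N (P \<inter> N)" "P' \<in> profiles_inducing \<P> N (P \<inter> N)"
            using P by (auto simp: profiles_inducing_def)
          then obtain s where s: "s \<in> M (P \<inter> N)" "distinguishes s P P'"
            using M(2)[of "P \<inter> N"] P(3) unfolding solution_def set_distinguishes_def by meson
          have "n \<in> P \<or> sep_inv n \<in> P" if "n \<in> N" for n
            using k_profile_cases[OF k[OF P(1)]] N_ord[OF that] by (meson less_SucI)
          then have "P \<inter> N \<in> consistent_orientations G N"
            using profile_orientation[OF k_profile_consistent[OF k[OF P(1)]] sys] by blast
          then show ?thesis
            using eff[OF s ind] s(1) by blast
        next
          case False
          then obtain n where "n \<in> N"
            "efficiently_distinguishes G n (truncate_profile l P) (truncate_profile l P')"
            using sol P(1,2) unfolding k_solution_def by blast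
          then show ?thesis
            using efficiently_distinguishes_truncate by blast
        qed
      qed
    qed
    ultimately show ?thesis by blast
  qed
qed

end

section \<open>Uniqueness\<close>

text \<open>The rules exclude one another. The only freedom is the choice of \<open>M\<close>, which
  affects the value only through its values on consistent orientations, where the induction
  hypothesis fixes them.\<close>

lemma strategy_eval_unique:
  assumes "strategy_eval G \<sigma> S \<P> N" "strategy_eval G \<sigma> S \<P> N'"
  shows "N = N'"
  using assms
proof (induction arbitrary: N' rule: strategy_eval.induct)
  case (empty \<P> \<sigma>)
  from empty.prems show ?case by (cases rule: strategy_eval.cases) auto
next
  case (reduce S \<P> \<sigma> N)
  note IH = reduce.IH and hyps = reduce.hyps
  from reduce.prems show ?case
  proof (cases rule: strategy_eval.cases)
    case empty
    then show ?thesis using hyps(2) by blast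
  next
    case reduce
    then show ?thesis by (intro IH)
  next
    case split
    then show ?thesis using hyps(3,4) by blast
  qed
next
  case (split S \<P> \<sigma> N M)
  note IH = split.IH and hyps = split.hyps
  from split.prems show ?case
  proof (cases rule: strategy_eval.cases)
    case empty
    then show ?thesis using hyps(2) by blast
  next
    case reduce
    then show ?thesis using hyps(3) by blast
  next
    case (split N0 M0)
    have N0: "N0 = N"
      using \<open>N0 = apply_op (\<sigma> 0) S \<P>\<close> hyps(4) by simp
    have "M Q = M0 Q" if "Q \<in> consistent_orientations G N" for Q
      using IH[OF that] split(8) that N0 by blast
    then show ?thesis
      using \<open>N' = _\<close> N0 by simp
  qed
qed

text \<open>The condition \<open>\<Sigma> \<noteq> []\<close> keeps the two rules apart, and the
  last entry of the list and the rest are determined.\<close>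

lemma k_strategy_eval_unique:
  assumes "k_strategy_eval G \<Sigma> \<P> N" "k_strategy_eval G \<Sigma> \<P> N'"
  shows "N = N'"
  using assms
proof (induction arbitrary: N' rule: k_strategy_eval.induct)
  case (single \<sigma> \<P> N)
  from single.prems show ?case
  proof (cases rule: k_strategy_eval.cases)
    case single
    with \<open>strategy_eval G \<sigma> _ \<P> N\<close> show ?thesis
      by (intro strategy_eval_unique)
  qed simp
next
  case (snoc \<Sigma> \<P> N S \<sigma> M)
  from snoc.prems show ?case
  proof (cases rule: k_strategy_eval.cases)
    case (single \<sigma>')
    then show ?thesis using snoc.hyps(1) by simp
  next
    case (snoc \<Sigma>' N0 S0 \<sigma>' M0)
    then have eq: "\<Sigma>' = \<Sigma>" "\<sigma>' = \<sigma>" by simp_all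
    have "N0 = N"
      using snoc.IH snoc(4) eq by blast
    moreover have "M Q = M0 Q" if "Q \<in> consistent_orientations G N" for Q
      using strategy_eval_unique snoc.hyps snoc(7,8) that \<open>N0 = N\<close> eq by metis
    ultimately show ?thesis
      using snoc(2) by simp
  qed
qed

section \<open>Invariance under isomorphisms\<close>

text \<open>Stated with join and inverse instead of coordinates, the condition can be carried
  through \<open>map_sep\<close>.\<close>

lemma profile_iff:
  "profile G P \<longleftrightarrow> consistent G P \<and> (\<forall>s \<in> P. \<forall>t \<in> P. sep_inv (sep_sup s t) \<notin> P)"
  unfolding profile_def sep_sup_def sep_inv_def by fastforce

lemma separation_iff:
  "separation G s \<longleftrightarrow> fst s \<union> snd s = pverts G \<and>
    (\<forall>u \<in> fst s - snd s. \<forall>v \<in> snd s - fst s. (u, v) \<notin> parcs G)"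
  by (cases s) (auto simp: separation_def)

lemma map_sep_simps [simp]:
  "fst (map_sep f s) = f ` fst s" "snd (map_sep f s) = f ` snd s"
  by (simp_all add: map_sep_def)

lemma map_sep_inv: "map_sep f (sep_inv s) = sep_inv (map_sep f s)"
  by (simp add: prod_eq_iff sep_inv_def)

text \<open>The map \<open>f\<close> is controlled only on the vertices of \<open>G\<close>, so its
  action on pairs of sets is injective only on separations. This is why the transport lemmas carry
  hypotheses of membership or inclusion in \<open>seps\<close>.\<close>

locale graph_iso = G: pair_graph G + H: pair_graph H
  for G :: "'a pair_pre_digraph" and H :: "'b pair_pre_digraph" +
  fixes f :: "'a \<Rightarrow> 'b"
  assumes iso: "graph_isomorphism f G H"
begin

abbreviation F :: "'a sep \<Rightarrow> 'b sep" where
  "F \<equiv> map_sep f"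

abbreviation seps :: "'a sep set" where
  "seps \<equiv> {s. separation G s}"

section \<open>Transport of single separations\<close>

lemma inj_f: "inj_on f (pverts G)"
  and image_f: "f ` pverts G = pverts H"
  and arcs_f: "u \<in> pverts G \<Longrightarrow> v \<in> pverts G \<Longrightarrow> (f u, f v) \<in> parcs H \<longleftrightarrow> (u, v) \<in> parcs G"
  using iso unfolding graph_isomorphism_def bij_betw_def by blast+

lemma image_subset_image_iff:
  "A \<subseteq> pverts G \<Longrightarrow> B \<subseteq> pverts G \<Longrightarrow> f ` A \<subseteq> f ` B \<longleftrightarrow> A \<subseteq> B"
  using inj_on_image_eq_iff[OF inj_f, of "A \<union> B" B] by (simp add: image_Un flip: subset_Un_eq)

lemma sides:
  assumes "s \<in> seps"
  shows "fst s \<subseteq> pverts G" "snd s \<subseteq> pverts G" "fst s \<union> snd s = pverts G"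
    "u \<in> fst s - snd s \<Longrightarrow> v \<in> snd s - fst s \<Longrightarrow> (u, v) \<notin> parcs G"
  using assms unfolding separation_def by (auto split: prod.splits)

lemma sep_le_map: "s \<in> seps \<Longrightarrow> t \<in> seps \<Longrightarrow> sep_le (F s) (F t) \<longleftrightarrow> sep_le s t"
  using sides(1,2) image_subset_image_iff by (simp add: sep_le_def)

lemma sep_inv_seps: "s \<in> seps \<Longrightarrow> sep_inv s \<in> seps"
  by simp

lemma sep_inv_le_map:
  "s \<in> seps \<Longrightarrow> t \<in> seps \<Longrightarrow> sep_le (sep_inv (F t)) (F s) \<longleftrightarrow> sep_le (sep_inv t) s"
  using sep_le_map[OF sep_inv_seps] by (simp add: map_sep_inv)

lemma sep_nested_map: "s \<in> seps \<Longrightarrow> t \<in> seps \<Longrightarrow> sep_nested (F s) (F t) \<longleftrightarrow> sep_nested s t"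
  using sep_inv_seps sep_le_map by (simp only: sep_nested_iff map_sep_inv[symmetric])

lemma sep_order_map: "s \<in> seps \<Longrightarrow> sep_order (F s) = sep_order s"
proof -
  assume s: "s \<in> seps"
  have "f ` fst s \<inter> f ` snd s = f ` (fst s \<inter> snd s)"
    using inj_on_image_Int[OF inj_f sides(1,2)[OF s]] by simp
  moreover have "inj_on f (fst s \<inter> snd s)"
    using inj_on_subset[OF inj_f] sides(1)[OF s] by blast
  ultimately show ?thesis
    by (simp add: sep_order_def card_image)
qed

lemma proper_sep_map: "s \<in> seps \<Longrightarrow> proper_sep (F s) \<longleftrightarrow> proper_sep s"
  using sep_le_map sep_inv_seps
  by (simp only: G.proper_sep_iff H.proper_sep_iff map_sep_inv[symmetric])

lemma sep_sup_map:
  assumes "s \<in> seps" "t \<in> seps"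
  shows "F (sep_sup s t) = sep_sup (F s) (F t)"
  using sides assms inj_on_image_Int[OF inj_f] by (simp add: prod_eq_iff sep_sup_def image_Un)

lemma separation_map:
  assumes "s \<in> seps"
  shows "separation H (F s)"
proof -
  have "(f u, f v) \<notin> parcs H" if "u \<in> fst s" "f u \<notin> f ` snd s" "v \<in> snd s" "f v \<notin> f ` fst s" for u v
  proof -
    have "u \<in> pverts G" "v \<in> pverts G" "u \<notin> snd s" "v \<notin> fst s"
      using that sides(1,2)[OF assms] by blast+
    then show ?thesis
      using sides(4)[OF assms] that arcs_f by simp
  qed
  moreover have "f ` fst s \<union> f ` snd s = pverts H"
    using sides(3)[OF assms] image_f by blast
  ultimately show ?thesis
    unfolding separation_iff map_sep_simps by blast
qed

lemma inj_F: "inj_on F seps"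
proof (rule inj_onI)
  fix s t assume "s \<in> seps" "t \<in> seps" "F s = F t"
  then show "s = t"
    using sep_le_map sep_le_antisym sep_le_refl by metis
qed

lemma image_F: "F ` seps = {t. separation H t}"
proof
  show "F ` seps \<subseteq> {t. separation H t}"
    using separation_map by blast
  show "{t. separation H t} \<subseteq> F ` seps"
  proof
    fix t assume "t \<in> {t. separation H t}"
    then have t: "fst t \<union> snd t = pverts H" "fst t \<subseteq> pverts H" "snd t \<subseteq> pverts H"
      "\<And>u v. u \<in> fst t - snd t \<Longrightarrow> v \<in> snd t - fst t \<Longrightarrow> (u, v) \<notin> parcs H"
      unfolding separation_def by (auto split: prod.splits)
    \<comment> \<open>Preimages are cut down to the vertices of \<open>G\<close>, because
      \<open>f\<close> may take values in \<open>H\<close> elsewhere too.\<close>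
    define s where "s = ({v \<in> pverts G. f v \<in> fst t}, {v \<in> pverts G. f v \<in> snd t})"
    have F: "t = F s"
      using t(2,3) image_f by (auto simp: s_def prod_eq_iff)
    have "f v \<in> fst t \<or> f v \<in> snd t" if "v \<in> pverts G" for v
      using that t(1) image_f by blast
    moreover have "(u, v) \<notin> parcs G" if "u \<in> fst s - snd s" "v \<in> snd s - fst s" for u v
      using that t(4)[of "f u" "f v"] arcs_f by (auto simp: s_def)
    ultimately have "separation G s"
      unfolding separation_def by (auto simp: s_def)
    then show "t \<in> F ` seps"
      using F by blast
  qed
qed

lemma F_mem_iff: "s \<in> seps \<Longrightarrow> A \<subseteq> seps \<Longrightarrow> F s \<in> F ` A \<longleftrightarrow> s \<in> A"
  using inj_on_image_mem_iff[OF inj_F] by blast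

lemma F_Int: "A \<subseteq> seps \<Longrightarrow> B \<subseteq> seps \<Longrightarrow> F ` (A \<inter> B) = F ` A \<inter> F ` B"
  using inj_on_image_Int[OF inj_F] by blast

lemma F_image_eq_iff: "A \<subseteq> seps \<Longrightarrow> B \<subseteq> seps \<Longrightarrow> F ` A = F ` B \<longleftrightarrow> A = B"
  using inj_on_image_eq_iff[OF inj_F] by blast

text \<open>Reduces the transport of a set given by a property to an equivalence on
  \<open>A\<close>, once both properties confine their elements to \<open>A\<close> and its
  image.\<close>

lemma F_Collect:
  assumes "\<And>t. \<psi> t \<Longrightarrow> t \<in> F ` A" "\<And>s. \<phi> s \<Longrightarrow> s \<in> A" "\<And>s. s \<in> A \<Longrightarrow> \<psi> (F s) \<longleftrightarrow> \<phi> s"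
  shows "{t. \<psi> t} = F ` {s. \<phi> s}"
  using assms by blast

lemma F_filter:
  assumes "\<And>s. s \<in> A \<Longrightarrow> \<psi> (F s) \<longleftrightarrow> \<phi> s"
  shows "{t \<in> F ` A. \<psi> t} = F ` {s \<in> A. \<phi> s}"
  using assms by blast

section \<open>Transport of profiles and tasks\<close>

lemma consistent_map:
  assumes "P \<subseteq> seps"
  shows "consistent H (F ` P) \<longleftrightarrow> consistent G P"
proof -
  have "separation H (F s)" "separation G s" if "s \<in> P" for s
    using that assms separation_map by blast+
  moreover have "sep_le (sep_inv (F t)) (F s) \<longleftrightarrow> sep_le (sep_inv t) s" if "s \<in> P" "t \<in> P" for s t
    using that assms sep_inv_le_map by blast
  ultimately show ?thesis
    unfolding G.consistent_iff H.consistent_iff by auto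
qed

lemma inv_F_mem_iff: "s \<in> seps \<Longrightarrow> A \<subseteq> seps \<Longrightarrow> sep_inv (F s) \<in> F ` A \<longleftrightarrow> sep_inv s \<in> A"
  using F_mem_iff[OF sep_inv_seps] by (simp add: map_sep_inv)

lemma profile_map:
  assumes "profile G P"
  shows "profile H (F ` P)"
proof -
  have P: "P \<subseteq> seps"
    using assms G.profile_consistent G.consistent_iff by blast
  have "sep_inv (sep_sup (F s) (F t)) \<notin> F ` P" if "s \<in> P" "t \<in> P" for s t
  proof -
    have "s \<in> seps" "t \<in> seps"
      using that P by blast+
    then have "sep_sup (F s) (F t) = F (sep_sup s t)" "sep_sup s t \<in> seps"
      using sep_sup_map G.separation_sup by simp_all
    then show ?thesis
      using inv_F_mem_iff[OF _ P] assms that unfolding profile_iff by metis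
  qed
  then show ?thesis
    using assms consistent_map[OF P] unfolding profile_iff by blast
qed

lemma distinguishes_map:
  assumes "s \<in> seps" "P \<subseteq> seps" "P' \<subseteq> seps"
  shows "distinguishes (F s) (F ` P) (F ` P') \<longleftrightarrow> distinguishes s P P'"
  using F_mem_iff inv_F_mem_iff assms by (simp add: distinguishes_def)

lemma feasible_task_subset:
  assumes "feasible_task G S \<P>"
  shows "S \<subseteq> seps" "P \<in> \<P> \<Longrightarrow> P \<subseteq> seps"
  using feasible_task_separation[OF assms] feasible_task_consistent[OF assms] G.consistent_iff
  by blast+

lemma feasible_task_map:
  assumes f: "feasible_task G S \<P>"
  shows "feasible_task H (F ` S) (image F ` \<P>)"
proof (rule H.feasible_taskI)
  note sub = feasible_task_subset[OF f]
  have seps: "s \<in> seps" if "s \<in> S" for s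
    using that sub(1) by blast
  show "separation H t" if "t \<in> F ` S" for t
    using that seps separation_map by blast
  show "sep_inv t \<in> F ` S" if "t \<in> F ` S" for t
    using that feasible_task_inv[OF f] by (auto simp flip: map_sep_inv)
  show "proper_sep t" if "t \<in> F ` S" for t
    using that seps proper_sep_map feasible_task_proper[OF f] by blast
  show "profile H T" if "T \<in> image F ` \<P>" for T
    using that profile_map feasible_task_profile[OF f] by blast
  show "t \<in> T \<or> sep_inv t \<in> T" if T: "T \<in> image F ` \<P>" and t: "t \<in> F ` S" for t T
  proof -
    obtain P s where "P \<in> \<P>" "T = F ` P" "s \<in> S" "t = F s"
      using T t by blast
    then show ?thesis
      using feasible_task_orients[OF f, of P s] by (auto simp flip: map_sep_inv)
  qed
  show "\<exists>t \<in> F ` S. distinguishes t T T'"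
    if T: "T \<in> image F ` \<P>" "T' \<in> image F ` \<P>" "T \<noteq> T'" for T T'
  proof -
    obtain P P' where P: "P \<in> \<P>" "P' \<in> \<P>" "T = F ` P" "T' = F ` P'"
      using T by blast
    then obtain s where "s \<in> S" "distinguishes s P P'"
      using feasible_task_distinguishes[OF f] T(3) by blast
    then show ?thesis
      using distinguishes_map[OF seps sub(2)[OF P(1)] sub(2)[OF P(2)]] P(3,4) by blast
  qed
  fix T T' t u
  assume T: "T \<in> image F ` \<P>" "T' \<in> image F ` \<P>" and tu: "t \<in> F ` S" "u \<in> F ` S" "sep_cross t u"
    and o: "t \<in> T" "u \<in> T" "sep_inv t \<in> T'" "sep_inv u \<in> T'"
  obtain P P' r s where P: "P \<in> \<P>" "P' \<in> \<P>" "T = F ` P" "T' = F ` P'"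
    and rs: "r \<in> S" "s \<in> S" "t = F r" "u = F s"
    using T tu by blast
  have "sep_cross r s"
    using tu(3) rs sep_nested_map[OF seps[OF rs(1)] seps[OF rs(2)]] by simp
  moreover have "r \<in> P" "s \<in> P" "sep_inv r \<in> P'" "sep_inv s \<in> P'"
    using o P rs F_mem_iff inv_F_mem_iff seps sub(2) by metis+
  ultimately obtain v where v: "v \<in> P" "v \<in> S" "sep_le (sep_sup r s) v"
    using feasible_task_sup[OF f rs(1,2) _ P(1,2)] by blast
  have "sep_sup r s \<in> seps"
    using rs(1,2) seps G.separation_sup by simp
  then have "sep_le (F (sep_sup r s)) (F v)"
    using v(2,3) sep_le_map seps by blast
  then have "sep_le (sep_sup t u) (F v)"
    using sep_sup_map[OF seps[OF rs(1)] seps[OF rs(2)]] rs(3,4) by simp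
  then show "\<exists>v \<in> T \<inter> F ` S. sep_le (sep_sup t u) v"
    using v P(3) by blast
qed

lemma reduction_map:
  assumes "S \<subseteq> seps" "\<And>P. P \<in> \<P> \<Longrightarrow> P \<subseteq> seps"
  shows "reduction (F ` S) (image F ` \<P>) = F ` reduction S \<P>"
proof -
  have "(\<exists>P \<in> \<P>. \<exists>P' \<in> \<P>. distinguishes (F s) (F ` P) (F ` P')) \<longleftrightarrow>
      (\<exists>P \<in> \<P>. \<exists>P' \<in> \<P>. distinguishes s P P')" if "s \<in> S" for s
  proof (intro bex_cong refl)
    fix P P' assume "P \<in> \<P>" "P' \<in> \<P>"
    then show "distinguishes (F s) (F ` P) (F ` P') \<longleftrightarrow> distinguishes s P P'"
      using distinguishes_map[OF _ assms(2) assms(2)] that assms(1) by blast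
  qed
  then show ?thesis
    unfolding reduction_def by (intro F_filter) simp
qed

section \<open>Transport of the operations\<close>

lemma sep_maximal_map:
  assumes "S \<subseteq> seps" "s \<in> S"
  shows "sep_maximal (F s) (F ` S) \<longleftrightarrow> sep_maximal s S"
proof -
  have "F t = F s \<longleftrightarrow> t = s" "sep_le (F s) (F t) \<longleftrightarrow> sep_le s t" if "t \<in> S" for t
    using that assms inj_on_eq_iff[OF inj_F] sep_le_map by blast+
  then show ?thesis
    using assms(2) by (auto simp: sep_maximal_def)
qed

lemma nested_set_map:
  assumes "S \<subseteq> seps"
  shows "nested_set (F ` S) \<longleftrightarrow> nested_set S"
  using assms sep_nested_map unfolding nested_set_def by blast

lemma nested_with_map:
  assumes "S \<subseteq> seps" "s \<in> seps"
  shows "nested_with (F s) (F ` S) \<longleftrightarrow> nested_with s S"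
  using assms sep_nested_map unfolding nested_with_def by blast

lemma Collect_sep_maximal_map:
  assumes "S \<subseteq> seps"
  shows "{t. sep_maximal t (F ` S)} = F ` {s. sep_maximal s S}"
  by (rule F_Collect[where A = S]) (use sep_maximal_map[OF assms] in \<open>auto simp: sep_maximal_def\<close>)

lemma Collect_extremal_map:
  assumes "S \<subseteq> seps"
  shows "{t. extremal (F ` S) t} = F ` {s. extremal S s}"
proof (rule F_Collect[where A = S])
  fix s assume s: "s \<in> S"
  have "sep_le (F t) (F s) \<longleftrightarrow> sep_le t s" "sep_le (sep_inv (F t)) (F s) \<longleftrightarrow> sep_le (sep_inv t) s"
    if "t \<in> S" for t
    using that s assms sep_le_map sep_inv_le_map by blast+
  then show "extremal (F ` S) (F s) \<longleftrightarrow> extremal S s"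
    using s by (auto simp: extremal_def)
qed (auto simp: extremal_def)

lemma Collect_locally_maximal_map:
  assumes "S \<subseteq> seps" "\<And>P. P \<in> \<P> \<Longrightarrow> P \<subseteq> seps"
  shows "{t. locally_maximal (F ` S) (image F ` \<P>) t} = F ` {s. locally_maximal S \<P> s}"
proof -
  have max: "{t. sep_maximal t (F ` P \<inter> F ` S)} = F ` {s. sep_maximal s (P \<inter> S)}" if "P \<in> \<P>" for P
    using Collect_sep_maximal_map[of "P \<inter> S"] F_Int[OF assms(2)[OF that] assms(1)] assms(1) by auto
  have ws: "well_separated (F ` S) (F ` P) \<longleftrightarrow> well_separated S P" if "P \<in> \<P>" for P
  proof -
    have "{s. sep_maximal s (P \<inter> S)} \<subseteq> seps"
      using assms(1) by (auto simp: sep_maximal_def)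
    then show ?thesis
      using nested_set_map unfolding well_separated_def max[OF that] by blast
  qed
  \<comment> \<open>Written as a union over the well separated profiles, the set can be transported
    one profile at a time.\<close>
  have "{t. locally_maximal (F ` S) (image F ` \<P>) t} =
      (\<Union>P \<in> {P \<in> \<P>. well_separated (F ` S) (F ` P)}. {t. sep_maximal t (F ` P \<inter> F ` S)})"
    by (auto simp: locally_maximal_def)
  also have "\<dots> = (\<Union>P \<in> {P \<in> \<P>. well_separated S P}. F ` {s. sep_maximal s (P \<inter> S)})"
    using max ws by auto
  also have "\<dots> = F ` {s. locally_maximal S \<P> s}"
    unfolding locally_maximal_def by blast
  finally show ?thesis .
qed

lemma apply_op_map:
  assumes "S \<subseteq> seps" "\<And>P. P \<in> \<P> \<Longrightarrow> P \<subseteq> seps"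
  shows "apply_op op (F ` S) (image F ` \<P>) = F ` apply_op op S \<P>"
proof -
  have inv: "sep_inv ` F ` A = F ` sep_inv ` A" for A
    by (simp add: image_image map_sep_inv)
  have ext: "ext (F ` T) (image F ` \<P>) = F ` ext T \<P>"
    and loc: "loc (F ` T) (image F ` \<P>) = F ` loc T \<P>"
    and all: "all_nested (F ` T) (image F ` \<P>) = F ` all_nested T \<P>" if T: "T \<subseteq> seps" for T
  proof -
    show "ext (F ` T) (image F ` \<P>) = F ` ext T \<P>"
      unfolding ext_def Collect_extremal_map[OF T] inv by (simp add: image_Un)
    show "loc (F ` T) (image F ` \<P>) = F ` loc T \<P>"
    proof -
      have "{t. locally_maximal (F ` T) (image F ` \<P>) t} = F ` {s. locally_maximal T \<P> s}"
        by (rule Collect_locally_maximal_map[OF T]) (rule assms(2))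
      then show ?thesis
        unfolding loc_def by (simp only: inv image_Un)
    qed
    have "nested_with (F s) (F ` T) \<longleftrightarrow> nested_with s T" if "s \<in> T" for s
      using nested_with_map[OF T] T that by blast
    then show "all_nested (F ` T) (image F ` \<P>) = F ` all_nested T \<P>"
      unfolding all_nested_def by (intro F_filter) simp
  qed
  have red: "reduction (F ` S) (image F ` \<P>) = F ` reduction S \<P>" "reduction S \<P> \<subseteq> seps"
    using reduction_map[OF assms] assms(1) by (auto simp: reduction_def)
  show ?thesis
    using ext loc all assms(1) red by (cases op) simp_all
qed

section \<open>Transport of orientations and of the recursion\<close>

lemma separation_system_map:
  assumes "separation_system G N"
  shows "separation_system H (F ` N)"
proof -
  have "separation H (F s)" "sep_inv (F s) \<in> F ` N" if "s \<in> N" for s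
    using assms that separation_map[of s] map_sep_inv[of f s, symmetric]
    unfolding separation_system_def by simp_all
  then show ?thesis
    unfolding separation_system_def by blast
qed

lemma consistent_orientations_map:
  assumes N: "N \<subseteq> seps"
  shows "consistent_orientations H (F ` N) = image F ` consistent_orientations G N"
proof -
  have "F ` Q \<in> consistent_orientations H (F ` N) \<longleftrightarrow> Q \<in> consistent_orientations G N"
    if Q: "Q \<subseteq> N" for Q
  proof -
    have sub: "Q \<subseteq> seps"
      using N Q by blast
    have "F n \<in> F ` Q \<longleftrightarrow> n \<in> Q" "sep_inv (F n) \<in> F ` Q \<longleftrightarrow> sep_inv n \<in> Q" if "n \<in> N" for n
      using F_mem_iff[OF _ sub] inv_F_mem_iff[OF _ sub] that N by blast+
    then show ?thesis
      unfolding G.consistent_orientations_iff H.consistent_orientations_iff consistent_map[OF sub]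
      using Q by blast
  qed
  note iff = this
  show ?thesis
  proof (intro subset_antisym subsetI)
    fix T assume T: "T \<in> consistent_orientations H (F ` N)"
    then have "T \<subseteq> F ` N"
      by (simp add: H.consistent_orientations_iff)
    then obtain Q where "Q \<subseteq> N" "T = F ` Q"
      by (meson subset_image_iff)
    then show "T \<in> image F ` consistent_orientations G N"
      using iff T by simp
  next
    fix T assume "T \<in> image F ` consistent_orientations G N"
    then obtain Q where Q: "Q \<in> consistent_orientations G N" "T = F ` Q"
      by blast
    then have "Q \<subseteq> N"
      by (simp add: G.consistent_orientations_iff)
    then show "T \<in> consistent_orientations H (F ` N)"
      using iff Q by simp
  qed
qed

lemma seps_splitting_map:
  assumes "S \<subseteq> seps" "Q \<subseteq> seps"
  shows "seps_splitting H (F ` S) (F ` Q) = F ` seps_splitting G S Q"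
proof -
  have "splits H (F s) (F ` Q) \<longleftrightarrow> splits G s Q" if "s \<in> S" for s
  proof -
    have "insert s Q \<subseteq> seps" "insert (sep_inv s) Q \<subseteq> seps"
      using that assms by auto
    then show ?thesis
      unfolding splits_def using consistent_map by (metis image_insert map_sep_inv)
  qed
  then show ?thesis
    unfolding seps_splitting_def by (intro F_filter) simp
qed

lemma profiles_inducing_map:
  assumes "N \<subseteq> seps" "Q \<subseteq> seps" "\<And>P. P \<in> \<P> \<Longrightarrow> P \<subseteq> seps"
  shows "profiles_inducing (image F ` \<P>) (F ` N) (F ` Q) = image F ` profiles_inducing \<P> N Q"
proof -
  have "F ` P \<inter> F ` N = F ` Q \<longleftrightarrow> P \<inter> N = Q" if "P \<in> \<P>" for P
    using F_Int[OF assms(3)[OF that] assms(1)] F_image_eq_iff[of "P \<inter> N" Q] assms(1,2) by auto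
  then show ?thesis
    unfolding profiles_inducing_def by auto
qed

lemma truncate_profile_map:
  assumes "\<And>P. P \<in> \<P> \<Longrightarrow> P \<subseteq> seps"
  shows "truncate_profile l ` image F ` \<P> = image F ` truncate_profile l ` \<P>"
proof -
  have "truncate_profile l (F ` P) = F ` truncate_profile l P" if "P \<in> \<P>" for P
  proof -
    have "sep_order (F s) = sep_order s" if "s \<in> P" for s
      using assms[OF \<open>P \<in> \<P>\<close>] that sep_order_map by blast
    then show ?thesis
      unfolding truncate_profile_def by auto
  qed
  then show ?thesis
    by (simp add: image_image)
qed

text \<open>The rules index recursive values by orientations, so over \<open>H\<close> a function of
  \<open>T\<close> is required. Pulling \<open>T\<close> back recovers the orientation of which it
  is the image, and with it the value already known over \<open>G\<close>.\<close>

definition pull :: "'b sep set \<Rightarrow> 'a sep set" where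
  "pull T = {s \<in> seps. F s \<in> T}"

lemma pull_image: "Q \<subseteq> seps \<Longrightarrow> pull (F ` Q) = Q"
  using F_mem_iff unfolding pull_def by blast

lemma orientation_cases:
  assumes "N \<subseteq> seps" "T \<in> consistent_orientations H (F ` N)"
  obtains Q where "Q \<in> consistent_orientations G N" "T = F ` Q" "Q \<subseteq> seps" "pull T = Q"
proof -
  obtain Q where Q: "Q \<in> consistent_orientations G N" "T = F ` Q"
    using assms consistent_orientations_map by blast
  then have "Q \<subseteq> seps"
    using assms(1) unfolding G.consistent_orientations_iff by blast
  then show thesis
    using that Q pull_image by blast
qed

lemma UN_orientations_map:
  assumes "N \<subseteq> seps"
  shows "F ` N \<union> (\<Union>T \<in> consistent_orientations H (F ` N). F ` M (pull T)) =
    F ` (N \<union> (\<Union>Q \<in> consistent_orientations G N. M Q))"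
proof -
  have "pull (F ` Q) = Q" if "Q \<in> consistent_orientations G N" for Q
    using that assms pull_image unfolding G.consistent_orientations_iff by blast
  then have "(\<Union>T \<in> consistent_orientations H (F ` N). F ` M (pull T)) =
      (\<Union>Q \<in> consistent_orientations G N. F ` M Q)"
    unfolding consistent_orientations_map[OF assms] by simp
  then show ?thesis
    by (simp add: image_Un image_UN)
qed

text \<open>Each premise of each rule is transported separately. At a split, every orientation of
  the image of \<open>N\<close> is the image of an orientation \<open>Q\<close> of \<open>N\<close>,
  for which the induction hypothesis supplies the value.\<close>

lemma strategy_eval_map:
  assumes "strategy_eval G \<sigma> S \<P> N"
  shows "strategy_eval H \<sigma> (F ` S) (image F ` \<P>) (F ` N)"
  using assms
proof (induction rule: strategy_eval.induct)
  case (empty \<P> \<sigma>)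
  then show ?case
    using strategy_eval.empty[of H "image F ` \<P>" \<sigma>] feasible_task_map[of "{}" \<P>] by simp
next
  case (reduce S \<P> \<sigma> N)
  note sub = feasible_task_subset[OF reduce.hyps(1)]
  have red: "reduction (F ` S) (image F ` \<P>) = F ` reduction S \<P>"
    using reduction_map sub by blast
  have "F ` reduction S \<P> \<subset> F ` S"
    using reduce.hyps(4) F_image_eq_iff[of "reduction S \<P>" S] sub(1) by (auto simp: psubset_eq)
  then show ?case
    using strategy_eval.reduce[OF feasible_task_map[OF reduce.hyps(1)]] reduce.hyps(2,3) reduce.IH red
    by simp
next
  case (split S \<P> \<sigma> N M)
  note sub = feasible_task_subset[OF split.hyps(1)]
  have N: "N \<subseteq> seps"
    using split.hyps(5) by (auto simp: separation_system_def)
  have red: "reduction (F ` S) (image F ` \<P>) = F ` reduction S \<P>"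
    using reduction_map sub by blast
  have no: "\<not> (r_index \<sigma> = 0 \<and> reduction (F ` S) (image F ` \<P>) \<subset> F ` S)"
    using split.hyps(3) red by (auto simp: psubset_eq reduction_def)
  have N_eq: "F ` N = apply_op (\<sigma> 0) (F ` S) (image F ` \<P>)"
    using split.hyps(4) apply_op_map[OF sub] by simp
  have nested: "nested_set (F ` N)"
    using split.hyps(6) nested_set_map[OF N] by simp
  have "strategy_eval H (shift \<sigma>) (seps_splitting H (F ` S) T)
      (profiles_inducing (image F ` \<P>) (F ` N) T) (F ` M (pull T))"
    if "T \<in> consistent_orientations H (F ` N)" for T
    using that
  proof (rule orientation_cases[OF N])
    fix Q assume "Q \<in> consistent_orientations G N" "T = F ` Q" "Q \<subseteq> seps" "pull T = Q"
    then show ?thesis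
      using split.IH[of Q] seps_splitting_map[OF sub(1)] profiles_inducing_map[OF N _ sub(2)] by simp
  qed
  then have "strategy_eval H \<sigma> (F ` S) (image F ` \<P>)
      (F ` N \<union> (\<Union>T \<in> consistent_orientations H (F ` N). F ` M (pull T)))"
    using strategy_eval.split[OF feasible_task_map[OF split.hyps(1)] _ no N_eq
        separation_system_map[OF split.hyps(5)] nested] split.hyps(2) by simp
  then show ?case
    unfolding UN_orientations_map[OF N] .
qed

lemma k_strategy_eval_map:
  assumes "k_strategy_eval G \<Sigma> \<P> N" "\<And>P. P \<in> \<P> \<Longrightarrow> P \<subseteq> seps"
  shows "k_strategy_eval H \<Sigma> (image F ` \<P>) (F ` N)"
  using assms
proof (induction rule: k_strategy_eval.induct)
  case (single \<sigma> \<P> N)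
  have "{t. separation H t \<and> proper_sep t \<and> sep_order t < 1} =
      F ` {s. separation G s \<and> proper_sep s \<and> sep_order s < 1}"
    by (rule F_Collect[where A = seps])
      (use image_F separation_map proper_sep_map sep_order_map in auto)
  then show ?case
    using k_strategy_eval.single[of H \<sigma>] strategy_eval_map[OF single.hyps] by simp
next
  case (snoc \<Sigma> \<P> N S \<sigma> M)
  have N: "N \<subseteq> seps"
    using snoc.hyps(3) by (auto simp: separation_system_def)
  have sub: "P \<subseteq> seps" if "P \<in> truncate_profile (length \<Sigma>) ` \<P>" for P
    using that snoc.prems by (auto simp: truncate_profile_def)
  have ev: "k_strategy_eval H \<Sigma> (truncate_profile (length \<Sigma>) ` image F ` \<P>) (F ` N)"
    using snoc.IH(1)[OF sub] truncate_profile_map[OF snoc.prems] by simp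
  have nested: "nested_set (F ` N)"
    using snoc.hyps(4) nested_set_map[OF N] by simp
  have S_sub: "S \<subseteq> seps"
    using snoc.hyps(5) by blast
  have S: "F ` S = {t. separation H t \<and> proper_sep t \<and> sep_order t = length \<Sigma> \<and> nested_with t (F ` N)}"
    unfolding snoc.hyps(5)
    by (rule F_Collect[where A = seps, symmetric])
      (use image_F separation_map proper_sep_map sep_order_map nested_with_map[OF N] in auto)
  have "strategy_eval H \<sigma> (seps_splitting H (F ` S) T)
      (profiles_inducing (image F ` \<P>) (F ` N) T) (F ` M (pull T))"
    if "T \<in> consistent_orientations H (F ` N)" for T
    using that
  proof (rule orientation_cases[OF N])
    fix Q assume "Q \<in> consistent_orientations G N" "T = F ` Q" "Q \<subseteq> seps" "pull T = Q"
    then show ?thesis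
      using strategy_eval_map[OF snoc.hyps(6)[of Q]] seps_splitting_map[OF S_sub]
        profiles_inducing_map[OF N _ snoc.prems] by simp
  qed
  then have "k_strategy_eval H (\<Sigma> @ [\<sigma>]) (image F ` \<P>)
      (F ` N \<union> (\<Union>T \<in> consistent_orientations H (F ` N). F ` M (pull T)))"
    by (rule k_strategy_eval.snoc[OF snoc.hyps(1) ev separation_system_map[OF snoc.hyps(3)] nested S])
  then show ?case
    unfolding UN_orientations_map[OF N] .
qed

end

theorem theorem4p4:
  fixes G :: "'a pair_pre_digraph"
    and k :: nat
    and \<Sigma> :: "(nat \<Rightarrow> operation) list"
    and \<P> :: "'a sep set set"
  assumes "k \<ge> 1"
    and "k_strategy k \<Sigma>"
    and "pair_graph G"
    and "\<forall>P \<in> \<P>. k_profile G k P"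
  shows "(\<exists>!N. k_strategy_eval G \<Sigma> \<P> N) \<and>
    separation_system G (N_Sigma G \<Sigma> \<P>) \<and>
    nested_set (N_Sigma G \<Sigma> \<P>) \<and>
    (\<forall>s \<in> N_Sigma G \<Sigma> \<P>. essential G \<P> s \<and> sep_order s < k) \<and>
    (\<forall>P \<in> \<P>. \<forall>P' \<in> \<P>. P \<noteq> P' \<longrightarrow>
      (\<exists>s \<in> N_Sigma G \<Sigma> \<P>. efficiently_distinguishes G s P P')) \<and>
    (\<forall>(H :: 'b pair_pre_digraph) f. pair_graph H \<and> graph_isomorphism f G H \<longrightarrow>
      N_Sigma H \<Sigma> ((\<lambda>P. map_sep f ` P) ` \<P>) = map_sep f ` N_Sigma G \<Sigma> \<P>)"
proof -
  interpret G: pair_graph G by fact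
  have \<Sigma>: "\<Sigma> \<noteq> []" "\<forall>\<sigma> \<in> set \<Sigma>. range \<sigma> \<subseteq> reducing_ops" "length \<Sigma> = k"
    using assms(1,2) by (auto simp: k_strategy_def)
  obtain N where N: "k_strategy_eval G \<Sigma> \<P> N" "k_solution G \<P> N"
    using G.k_strategy_eval_exists[OF \<Sigma>(1,2)] \<Sigma>(3) assms(4) by blast
  have ex1: "\<exists>!N. k_strategy_eval G \<Sigma> \<P> N"
    using N(1) k_strategy_eval_unique by blast
  have N_eq: "N_Sigma G \<Sigma> \<P> = N"
    unfolding N_Sigma_def using N(1) k_strategy_eval_unique by (intro the_equality) blast+
  \<comment> \<open>An essential separation belongs to one of the profiles it distinguishes, and
    those contain only separations of order less than \<open>k\<close>.\<close>
  have ord: "sep_order s < k" if "s \<in> N" for s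
  proof -
    have "essential G \<P> s"
      using N(2) that by (simp add: k_solution_def)
    then obtain P P' where P: "P \<in> \<P>" "P' \<in> \<P>" "distinguishes s P P'"
      unfolding essential_def efficiently_distinguishes_def by blast
    then have "s \<in> P \<or> s \<in> P'"
      unfolding distinguishes_def by blast
    then show ?thesis
      using assms(4) P(1,2) unfolding k_profile_def by blast
  qed
  have iso: "N_Sigma H \<Sigma> ((\<lambda>P. map_sep f ` P) ` \<P>) = map_sep f ` N"
    if "pair_graph H" "graph_isomorphism f G H" for H :: "'b pair_pre_digraph" and f
  proof -
    interpret graph_iso G H f
      using that assms(3) by (simp add: graph_iso_def graph_iso_axioms_def)
    have "P \<subseteq> seps" if "P \<in> \<P>" for P
    proof -
      have "consistent G P"
        using assms(4) that G.k_profile_consistent by blast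
      then show ?thesis
        unfolding G.consistent_iff by blast
    qed
    \<comment> \<open>The transported derivation already proves existence over \<open>H\<close>;
      uniqueness there identifies its value with \<open>N_Sigma\<close>.\<close>
    then have "k_strategy_eval H \<Sigma> (image F ` \<P>) (F ` N)"
      using k_strategy_eval_map[OF N(1)] by blast
    then show ?thesis
      unfolding N_Sigma_def using k_strategy_eval_unique by (intro the_equality) blast+
  qed
  show ?thesis
    using ex1 iso ord N(2) unfolding N_eq k_solution_def by simp
qed
end
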